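(* Let $\mathcal T=(T(t))_{t\ge0}$ be a $C_0$-semigroup on a Hilbert space $H$. Assume there exist $\lambda>0$ and $\tau>0$ such that (i) the rescaled semigroup $e_{-\lambda}\mathcal T=(e^{-\lambda t}T(t))_{t\ge0}$ is similar to a semigroup of contractions, and (ii) $T(\tau)$ is similar to a contraction. Then $\mathcal T$ is similar to a semigroup of contractions, and $$\mathcal C(\mathcal T)\le\sqrt2\,\mathcal C(e_{-\lambda}\mathcal T)\,\frac{e^{2\lambda}-1}{2\lambda}+2\sqrt2\,C(T(\tau))\,M^2\max\{1,\sqrt\tau\},$$ where $M=\sup_{t\in[0,\tau]}\|T(t)\|$.
   Context: For $T\in\mathcal L(H)$: $C(T)=\inf\{\|R\|\|R^{-1}\|: R\text{ invertible},\ \|RTR^{-1}\|\le1\}$ ($=\infty$ if no such $R$ exists), and $T$ is similar to a contraction if such $R$ exists. For a $C_0$-semigroup $\mathcal S=(S(t))_{t\ge0}$ on $H$: $\mathcal C(\mathcal S)=\inf\{\|R\|\|R^{-1}\|: R\text{ invertible},\ \|RS(t)R^{-1}\|\le1\ \forall t\ge0\}$ ($=\infty$ if no such $R$ exists), and $\mathcal S$ is similar to a semigroup of contractions if such $R$ exists. *)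

theory Defs
  imports "HOL-Analysis.Analysis" "HOL-Library.Extended_Real"
begin

text \<open>A complex Hilbert space is modelled as a real Hilbert space (real inner product
  space that is complete) together with a complex structure J (multiplication by i):
  a real-linear isometry with J (J x) = - x. Complex scalar multiplication is
  (a + i b) x = a x + b J x, and the norm is then complex-homogeneous.\<close>

definition complex_structure :: "('a::real_inner \<Rightarrow> 'a) \<Rightarrow> bool" where
  "complex_structure J \<longleftrightarrow> linear J \<and> (\<forall>x. J (J x) = - x) \<and> (\<forall>x. norm (J x) = norm x)"

definition cplx_op :: "('a::real_normed_vector \<Rightarrow> 'a) \<Rightarrow> ('a \<Rightarrow>\<^sub>L 'a) \<Rightarrow> bool" where
  "cplx_op J T \<longleftrightarrow> (\<forall>x. T (J x) = J (T x))"

definition inv_pair :: "('a::real_normed_vector \<Rightarrow> 'a) \<Rightarrow> ('a \<Rightarrow>\<^sub>L 'a) \<Rightarrow> ('a \<Rightarrow>\<^sub>L 'a) \<Rightarrow> bool" where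
  "inv_pair J R Rinv \<longleftrightarrow> cplx_op J R \<and> cplx_op J Rinv \<and>
     R o\<^sub>L Rinv = id_blinfun \<and> Rinv o\<^sub>L R = id_blinfun"

definition similar_to_contraction :: "('a::real_normed_vector \<Rightarrow> 'a) \<Rightarrow> ('a \<Rightarrow>\<^sub>L 'a) \<Rightarrow> bool" where
  "similar_to_contraction J T \<longleftrightarrow>
     (\<exists>R Rinv. inv_pair J R Rinv \<and> norm (R o\<^sub>L T o\<^sub>L Rinv) \<le> 1)"

text \<open>C(T); the infimum of the empty set of extended reals is \<infinity>.\<close>
definition sim_const :: "('a::real_normed_vector \<Rightarrow> 'a) \<Rightarrow> ('a \<Rightarrow>\<^sub>L 'a) \<Rightarrow> ereal" where
  "sim_const J T = Inf {ereal (norm R * norm Rinv) | R Rinv.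
      inv_pair J R Rinv \<and> norm (R o\<^sub>L T o\<^sub>L Rinv) \<le> 1}"

definition C0_semigroup :: "('a::real_normed_vector \<Rightarrow> 'a) \<Rightarrow> (real \<Rightarrow> ('a \<Rightarrow>\<^sub>L 'a)) \<Rightarrow> bool" where
  "C0_semigroup J S \<longleftrightarrow>
     (\<forall>t\<ge>0. cplx_op J (S t)) \<and>
     S 0 = id_blinfun \<and>
     (\<forall>s t. s \<ge> 0 \<longrightarrow> t \<ge> 0 \<longrightarrow> S (s + t) = S s o\<^sub>L S t) \<and>
     (\<forall>x. ((\<lambda>t. blinfun_apply (S t) x) \<longlongrightarrow> x) (at_right 0))"

definition sg_similar_to_contractions :: "('a::real_normed_vector \<Rightarrow> 'a) \<Rightarrow> (real \<Rightarrow> ('a \<Rightarrow>\<^sub>L 'a)) \<Rightarrow> bool" where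
  "sg_similar_to_contractions J S \<longleftrightarrow>
     (\<exists>R Rinv. inv_pair J R Rinv \<and> (\<forall>t\<ge>0. norm (R o\<^sub>L S t o\<^sub>L Rinv) \<le> 1))"

definition sg_sim_const :: "('a::real_normed_vector \<Rightarrow> 'a) \<Rightarrow> (real \<Rightarrow> ('a \<Rightarrow>\<^sub>L 'a)) \<Rightarrow> ereal" where
  "sg_sim_const J S = Inf {ereal (norm R * norm Rinv) | R Rinv.
      inv_pair J R Rinv \<and> (\<forall>t\<ge>0. norm (R o\<^sub>L S t o\<^sub>L Rinv) \<le> 1)}"

end

theory Submission
  imports Defs
begin

text \<open>A semigroup is similar to a semigroup of contractions once there is an equivalent Hilbertian norm
  that decreases along it: the norm comes from a positive invertible operator, and its square root
  is the similarity. The norm is built as a quotient norm, in the way a dilation of \<open>T\<close> to a contraction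
  semigroup would produce it: the square of the new norm of \<open>x\<close> is the infimum of an energy over all
  histories with present state \<open>x\<close>. It is enough that the energy is a quadratic form which dominates
  the squared norm of the present state and does not increase when time passes.

  The energy is a combination of two terms. With \<open>m = min 1 tau\<close>, write the present state, for each
  \<open>s \<in> (0, m]\<close>, as the contribution of the last \<open>s\<close> time units plus \<open>T(s)\<close> applied to the state
  at time \<open>- s\<close>. The first part is controlled by the contractivity of \<open>e\<^sup>-\<^sup>\<lambda>\<^sup>t T(t)\<close>, at the cost of
  an exponential factor on \<open>(0, m]\<close> only. The second part is controlled by the isometric dilation of
  the contraction similar to \<open>T(tau)\<close>, averaged over all lattices of step \<open>tau\<close>. Averaging over \<open>s\<close>
  and optimising the combination makes the two constants add up.\<close>

subsection \<open>Hilbertian renormings\<close>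

text \<open>Writing \<open>n * t\<close> as an integer plus a remainder \<open>r\<close> in [0, 1)
  turns \<open>n\<close> times the defect at \<open>t\<close> into the defect at \<open>r\<close>,
  which is bounded independently of \<open>n\<close>.\<close>

lemma additive_locally_bounded_imp_linear:
  fixes g :: "real \<Rightarrow> real"
  assumes add: "\<And>s t. g (s + t) = g s + g t" and bnd: "\<And>t. \<bar>t\<bar> \<le> 1 \<Longrightarrow> \<bar>g t\<bar> \<le> K"
  shows "g t = t * g 1"
proof -
  have g0: "g 0 = 0" using add[of 0 0] by simp
  have gm: "g (- s) = - g s" for s using add[of s "- s"] g0 by simp
  have gn: "g (real n * s) = real n * g s" for n s
    by (induction n) (auto simp: g0 add algebra_simps)
  have gi: "g (of_int k) = of_int k * g 1" for k :: int
  proof (cases "k \<ge> 0")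
    case True
    then show ?thesis using gn[of "nat k" 1] by simp
  next
    case False
    then show ?thesis using gn[of "nat (- k)" 1] gm[of "of_int k"] by simp
  qed
  have "real n * \<bar>g t - t * g 1\<bar> \<le> \<bar>g 1\<bar> + K" for n
  proof -
    define r where "r = frac (real n * t)"
    have r: "0 \<le> r" "r < 1" by (auto simp: r_def frac_lt_1)
    have nt: "real n * t = of_int \<lfloor>real n * t\<rfloor> + r" by (simp add: r_def frac_def)
    have "real n * g t = of_int \<lfloor>real n * t\<rfloor> * g 1 + g r"
      using gn[of n t] add[of "of_int \<lfloor>real n * t\<rfloor>" r] gi[of "\<lfloor>real n * t\<rfloor>"] nt by simp
    also have "\<dots> = (real n * t - r) * g 1 + g r" using nt by simp
    finally have e: "real n * (g t - t * g 1) = g r - r * g 1" by (simp add: algebra_simps)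
    have "real n * \<bar>g t - t * g 1\<bar> = \<bar>real n * (g t - t * g 1)\<bar>" by (simp add: abs_mult)
    also have "\<dots> = \<bar>g r - r * g 1\<bar>" using e by simp
    also have "\<dots> \<le> \<bar>g r\<bar> + \<bar>r * g 1\<bar>" by linarith
    also have "\<dots> \<le> K + \<bar>g 1\<bar>"
      using bnd[of r] r by (intro add_mono) (auto simp: abs_mult mult_left_le_one_le)
    finally show ?thesis by simp
  qed
  then have "\<not> (\<bar>g t - t * g 1\<bar> > 0)"
    using reals_Archimedean3 by (meson not_less)
  then show ?thesis by simp
qed

text \<open>The Jordan-von Neumann argument: add the first and third parallelogram identities,
  subtract the other two, and let evenness cancel the mixed terms.\<close>

lemma polar_additive:
  fixes q :: "'a::real_vector \<Rightarrow> real"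
  assumes par: "\<And>x y. q (x + y) + q (x - y) = 2 * q x + 2 * q y"
  shows "q (x + y + z) - q (x + y - z) = (q (x + z) - q (x - z)) + (q (y + z) - q (y - z))"
proof -
  have q0: "q 0 = 0" using par[of 0 0] by simp
  have ev: "q (- v) = q v" for v using par[of 0 v] q0 by simp
  have 1: "q (x + z + y) + q (x + z - y) = 2 * q (x + z) + 2 * q y"
    "q (x - z + y) + q (x - z - y) = 2 * q (x - z) + 2 * q y"
    "q (y + z + x) + q (y + z - x) = 2 * q (y + z) + 2 * q x"
    "q (y - z + x) + q (y - z - x) = 2 * q (y - z) + 2 * q x"
    by (rule par)+
  have 2: "q (y + z - x) = q (x - z - y)" "q (y - z - x) = q (x + z - y)"
    using ev[of "y + z - x"] ev[of "y - z - x"] by (simp_all add: algebra_simps)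
  have 3: "x + z + y = x + y + z" "x - z + y = x + y - z" "y + z + x = x + y + z" "y - z + x = x + y - z"
    by (simp_all add: algebra_simps)
  show ?thesis using 1 unfolding 2 3 by linarith
qed

text \<open>The representing vector minimises \<open>F\<close>. The parallelogram law makes a
  minimising sequence Cauchy, and at its limit the first variation must vanish.\<close>

lemma riesz_representation:
  fixes f :: "'a::{real_inner, complete_space} \<Rightarrow> real"
  assumes "bounded_linear f"
  shows "\<exists>z. \<forall>x. f x = z \<bullet> x"
proof -
  interpret f: bounded_linear f by fact
  obtain K where K: "\<And>x. norm (f x) \<le> norm x * K" using f.bounded by blast
  define F where "F y = (norm y)\<^sup>2 - 2 * f y" for y
  have lower: "F y \<ge> - K\<^sup>2" for y
  proof -
    have "0 \<le> (norm y - K)\<^sup>2" by simp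
    then show ?thesis using K[of y] by (simp add: F_def power2_eq_square algebra_simps abs_le_iff)
  qed
  define I where "I = (INF y. F y)"
  have bdd: "bdd_below (range F)" using lower by (auto simp: bdd_below_def)
  have I: "I \<le> F y" for y unfolding I_def using bdd by (simp add: cINF_lower)
  have "\<exists>y. F y < I + 1 / real (Suc n)" for n
    using cINF_less_iff[of UNIV F "I + 1 / real (Suc n)"] bdd by (auto simp: I_def)
  then obtain y where y: "\<And>n. F (y n) < I + 1 / real (Suc n)" by metis
  have mid: "(norm (u - v))\<^sup>2 \<le> 2 * (F u - I) + 2 * (F v - I)" for u v
  proof -
    have "F ((1/2) *\<^sub>R (u + v)) = (F u + F v) / 2 - (norm (u - v))\<^sup>2 / 4"
      unfolding F_def by (simp add: f.add f.scaleR power2_norm_eq_inner inner_simps inner_commute field_simps)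
    then show ?thesis using I[of "(1/2) *\<^sub>R (u + v)"] by (simp add: field_simps)
  qed
  have "Cauchy y"
  proof (rule metric_CauchyI)
    fix e :: real assume e: "e > 0"
    obtain N where N: "1 / real (Suc N) < e\<^sup>2 / 4"
      using reals_Archimedean[of "e\<^sup>2 / 4"] e by (auto simp: inverse_eq_divide)
    have *: "F (y n) - I < e\<^sup>2 / 4" if "n \<ge> N" for n
    proof -
      have "1 / real (Suc n) \<le> 1 / real (Suc N)" using that by (intro divide_left_mono) auto
      then show ?thesis using y[of n] N by linarith
    qed
    have "dist (y m) (y n) < e" if "m \<ge> N" "n \<ge> N" for m n
    proof -
      have "(norm (y m - y n))\<^sup>2 < e\<^sup>2" using mid[of "y m" "y n"] *[OF that(1)] *[OF that(2)] by (simp add: field_simps)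
      then show ?thesis using e by (simp add: dist_norm power_less_imp_less_base)
    qed
    then show "\<exists>N. \<forall>m\<ge>N. \<forall>n\<ge>N. dist (y m) (y n) < e" by blast
  qed
  then obtain z where z: "y \<longlonglongrightarrow> z" using Cauchy_convergent convergent_def by blast
  have Fz: "(\<lambda>n. F (y n)) \<longlonglongrightarrow> F z"
    unfolding F_def by (intro tendsto_intros z f.tendsto)
  have lim: "(\<lambda>n. I + 1 / real (Suc n)) \<longlonglongrightarrow> I + 0"
    by (intro tendsto_add tendsto_const LIMSEQ_inverse_real_of_nat[unfolded inverse_eq_divide])
  have "F z \<le> I + 0"
    using LIMSEQ_le[OF Fz lim] y less_imp_le by blast
  then have min: "F z \<le> F v" for v using I[of v] by simp
  have "f x = z \<bullet> x" for x
  proof (cases "x = 0")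
    case True then show ?thesis by simp
  next
    case False
    define d where "d = f x - z \<bullet> x"
    \<comment> \<open>This \<open>t\<close> minimises \<open>F\<close> on the line through
      \<open>z\<close> in direction \<open>x\<close>; the decrease there would be
      \<open>d\<^sup>2 / (x \<bullet> x)\<close>.\<close>
    define t where "t = d / (x \<bullet> x)"
    have xx: "x \<bullet> x > 0" using False by simp
    have "F (z + t *\<^sub>R x) = F z + t\<^sup>2 * (x \<bullet> x) - 2 * t * d"
      unfolding F_def d_def power2_norm_eq_inner
      by (simp add: f.add f.scaleR inner_simps inner_commute power2_eq_square algebra_simps)
    then have "t\<^sup>2 * (x \<bullet> x) - 2 * t * d \<ge> 0" using min[of "z + t *\<^sub>R x"] by simp
    moreover have "t\<^sup>2 * (x \<bullet> x) - 2 * t * d = - (d\<^sup>2 / (x \<bullet> x))"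
      using xx by (simp add: t_def power2_eq_square field_simps)
    ultimately have "d\<^sup>2 / (x \<bullet> x) \<le> 0" by simp
    then have "d = 0" using xx by (simp add: divide_le_0_iff)
    then show ?thesis by (simp add: d_def)
  qed
  then show ?thesis by blast
qed

section \<open>Operators representing bounded quadratic forms\<close>

lemma norm_parallelogram:
  fixes x y :: "'a::real_inner"
  shows "(norm (x + y))\<^sup>2 + (norm (x - y))\<^sup>2 = 2 * (norm x)\<^sup>2 + 2 * (norm y)\<^sup>2"
  by (simp add: power2_norm_eq_inner inner_simps inner_commute)

text \<open>The polar form \<open>B\<close> is additive by the parallelogram law, and boundedness of
  \<open>q\<close> upgrades additivity to real homogeneity. Riesz representation of each
  \<open>B x\<close> then yields the operator.\<close>

lemma quadratic_form_operator:
  fixes q :: "'a::{real_inner, complete_space} \<Rightarrow> real"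
  assumes par: "\<And>x y. q (x + y) + q (x - y) = 2 * q x + 2 * q y"
    and bnd: "\<And>x. \<bar>q x\<bar> \<le> a * (norm x)\<^sup>2" and a: "0 \<le> a"
  shows "\<exists>X :: 'a \<Rightarrow>\<^sub>L 'a. norm X \<le> a \<and> (\<forall>x y. blinfun_apply X x \<bullet> y = (q (x + y) - q (x - y)) / 4)"
proof -
  define B where "B x y = (q (x + y) - q (x - y)) / 4" for x y
  have q0: "q 0 = 0" using par[of 0 0] by simp
  have ev: "q (- v) = q v" for v using par[of 0 v] q0 by simp
  have sym: "B x y = B y x" for x y
    using ev[of "x - y"] by (simp add: B_def add.commute)
  have addl: "B (x + y) z = B x z + B y z" for x y z
    using polar_additive[OF par, of x y z] unfolding B_def by argo
  have b0: "\<bar>B x y\<bar> \<le> a * ((norm x)\<^sup>2 + (norm y)\<^sup>2) / 2" for x y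
  proof -
    have "4 * \<bar>B x y\<bar> \<le> \<bar>q (x + y)\<bar> + \<bar>q (x - y)\<bar>" 
      using abs_triangle_ineq4[of "q (x + y)" "q (x - y)"] by (simp add: B_def)
    also have "\<dots> \<le> a * (norm (x + y))\<^sup>2 + a * (norm (x - y))\<^sup>2" by (intro add_mono bnd)
    also have "\<dots> = a * (2 * (norm x)\<^sup>2 + 2 * (norm y)\<^sup>2)" by (simp only: norm_parallelogram flip: distrib_left)
    finally show ?thesis by (simp add: algebra_simps)
  qed
  have scl: "B (t *\<^sub>R x) y = t * B x y" for t x y
  proof -
    have "B (t *\<^sub>R x) y = t * B (1 *\<^sub>R x) y"
    proof (rule additive_locally_bounded_imp_linear[where K = "a * ((norm x)\<^sup>2 + (norm y)\<^sup>2) / 2"])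
      fix s t :: real
      show "B ((s + t) *\<^sub>R x) y = B (s *\<^sub>R x) y + B (t *\<^sub>R x) y" by (simp add: scaleR_add_left addl)
    next
      fix t :: real assume t: "\<bar>t\<bar> \<le> 1"
      have "(norm (t *\<^sub>R x))\<^sup>2 \<le> (norm x)\<^sup>2"
        using t by (intro power_mono) (auto simp: mult_left_le_one_le)
      then have "a * ((norm (t *\<^sub>R x))\<^sup>2 + (norm y)\<^sup>2) / 2 \<le> a * ((norm x)\<^sup>2 + (norm y)\<^sup>2) / 2"
        using a by (intro divide_right_mono mult_left_mono add_right_mono) auto
      then show "\<bar>B (t *\<^sub>R x) y\<bar> \<le> a * ((norm x)\<^sup>2 + (norm y)\<^sup>2) / 2" using b0 order_trans by blast
    qed
    then show ?thesis by simp
  qed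
  have bb: "\<bar>B x y\<bar> \<le> a * norm x * norm y" for x y
  proof (cases "x = 0 \<or> y = 0")
    case True
    then have "B x y = 0" using scl[of 0 x y] scl[of 0 y x] sym[of x y] by auto
    then show ?thesis using a by simp
  next
    case False
    \<comment> \<open>At unit vectors the bound \<open>b0\<close> is just \<open>a\<close>, and
      homogeneity carries it back to a product of norms.\<close>
    define u where "u = (1 / norm x) *\<^sub>R x"
    define v where "v = (1 / norm y) *\<^sub>R y"
    have uv: "x = norm x *\<^sub>R u" "y = norm y *\<^sub>R v" "norm u = 1" "norm v = 1"
      using False by (auto simp: u_def v_def)
    have "B x y = norm x * (norm y * B u v)"
      by (subst uv(1), subst uv(2), subst scl, subst sym, subst scl, subst sym) simp
    moreover have "\<bar>B u v\<bar> \<le> a" using b0[of u v] uv by simp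
    ultimately have "\<bar>B x y\<bar> \<le> norm x * (norm y * a)"
      by (auto simp: abs_mult intro!: mult_left_mono)
    then show ?thesis by (simp add: algebra_simps)
  qed
  have "\<exists>z. \<forall>y. B x y = z \<bullet> y" for x
  proof (rule riesz_representation)
    show "bounded_linear (B x)"
      by (rule bounded_linear_intro[where K = "a * norm x"])
        (use bb sym addl scl in \<open>simp_all add: mult.commute mult.left_commute\<close>)
  qed
  then obtain X where X: "\<And>x y. B x y = X x \<bullet> y" by metis
  have nX: "norm (X x) \<le> norm x * a" for x
  proof (cases "X x = 0")
    case False
    have "norm (X x) * norm (X x) = B x (X x)" using X[of x "X x"] by (simp add: norm_eq_sqrt_inner)
    also have "\<dots> \<le> a * norm x * norm (X x)" using bb[of x "X x"] by linarith
    finally show ?thesis using False by (simp add: mult.commute)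
  qed (use a in simp)
  have bl: "bounded_linear X"
  proof (rule bounded_linear_intro[where K = a])
    fix x y show "X (x + y) = X x + X y"
      by (rule vector_eq_ldot[THEN iffD1]) (metis X addl inner_commute inner_add_left)
  next
    fix t x show "X (t *\<^sub>R x) = t *\<^sub>R X x"
      by (rule vector_eq_ldot[THEN iffD1]) (metis X scl inner_commute inner_scaleR_left)
  qed (rule nX)
  have "norm (Blinfun X) \<le> a"
    by (rule norm_blinfun_bound) (use a nX bl in \<open>auto simp: bounded_linear_Blinfun_apply mult.commute\<close>)
  then show ?thesis using X bl unfolding B_def
    by (intro exI[of _ "Blinfun X"]) (simp add: bounded_linear_Blinfun_apply)
qed

section \<open>Complex-linear square roots and inverses\<close>

lemma complex_structure_inner:
  assumes "complex_structure J"
  shows "J x \<bullet> J y = x \<bullet> y"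
proof -
  have "linear J" "\<And>x. norm (J x) = norm x" using assms by (auto simp: complex_structure_def)
  then have "(norm (J x + J y))\<^sup>2 = (norm (x + y))\<^sup>2" "(norm (J x))\<^sup>2 = (norm x)\<^sup>2" "(norm (J y))\<^sup>2 = (norm y)\<^sup>2"
    by (simp_all flip: linear_add)
  then show ?thesis
    unfolding power2_norm_eq_inner by (simp add: inner_simps inner_commute)
qed

text \<open>The library states this for the class \<open>banach\<close>, of which a type variable of sort
  \<open>{real_inner, complete_space}\<close> is not known to be an instance.\<close>

lemma complete_blinfun:
  "complete (UNIV :: ('a::real_normed_vector \<Rightarrow>\<^sub>L 'b::{real_normed_vector, complete_space}) set)"
proof (rule completeI)
  fix X :: "nat \<Rightarrow> 'a \<Rightarrow>\<^sub>L 'b" assume X: "Cauchy X"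
  have d: "norm (X m x - X n x) \<le> norm (X m - X n) * norm x" for m n x
    using norm_blinfun[of "X m - X n" x] by (simp add: blinfun.bilinear_simps)
  have ev: "\<exists>N. \<forall>m\<ge>N. \<forall>n\<ge>N. norm (X m - X n) < e" if "e > 0" for e
    using X that unfolding Cauchy_def dist_norm by blast
  have "Cauchy (\<lambda>n. X n x)" for x
  proof (rule metric_CauchyI)
    fix e :: real assume e: "e > 0"
    obtain N where N: "\<forall>m\<ge>N. \<forall>n\<ge>N. norm (X m - X n) < e / (norm x + 1)"
      using ev[of "e / (norm x + 1)"] e by (auto simp: add_nonneg_pos)
    have "dist (X m x) (X n x) < e" if "m \<ge> N" "n \<ge> N" for m n
    proof -
      have "norm (X m - X n) * norm x \<le> norm (X m - X n) * (norm x + 1)" by (intro mult_left_mono) auto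
      also have "\<dots> < e" using N that by (simp add: less_divide_eq add_nonneg_pos)
      finally show ?thesis using d[of m x n] by (simp add: dist_norm)
    qed
    then show "\<exists>N. \<forall>m\<ge>N. \<forall>n\<ge>N. dist (X m x) (X n x) < e" by blast
  qed
  then have "\<exists>l. (\<lambda>n. X n x) \<longlonglongrightarrow> l" for x
    using Cauchy_convergent convergent_def by blast
  then obtain L where L: "\<And>x. (\<lambda>n. X n x) \<longlonglongrightarrow> L x" by metis
  obtain K where K: "\<And>n. norm (X n) \<le> K" using Cauchy_Bseq[OF X] by (auto simp: Bseq_def)
  have bl: "bounded_linear L"
  proof (rule bounded_linear_intro[where K = K])
    show "L (x + y) = L x + L y" for x y
      using LIMSEQ_unique[OF L[of "x + y"]] tendsto_add[OF L[of x] L[of y]]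
      by (simp add: blinfun.bilinear_simps)
    show "L (r *\<^sub>R x) = r *\<^sub>R L x" for r x
      using LIMSEQ_unique[OF L[of "r *\<^sub>R x"]] tendsto_scaleR[OF tendsto_const L[of x]]
      by (simp add: blinfun.bilinear_simps)
    show "norm (L x) \<le> norm x * K" for x
    proof (rule LIMSEQ_le_const2[OF tendsto_norm[OF L[of x]]], intro exI allI impI)
      show "norm (X n x) \<le> norm x * K" for n
        using norm_blinfun[of "X n" x] mult_right_mono[OF K[of n] norm_ge_zero[of x]]
        by (simp add: mult.commute)
    qed
  qed
  have "X \<longlonglongrightarrow> Blinfun L"
  proof (rule metric_LIMSEQ_I)
    fix e :: real assume e: "e > 0"
    obtain N where N: "\<forall>m\<ge>N. \<forall>n\<ge>N. norm (X m - X n) < e / 2" using ev[of "e / 2"] e by auto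
    have "dist (X n) (Blinfun L) < e" if n: "n \<ge> N" for n
    proof -
      have "norm (X n - Blinfun L) \<le> e / 2"
      proof (rule norm_blinfun_bound)
        fix x
        have "norm (X n x - L x) \<le> e / 2 * norm x"
        proof (rule LIMSEQ_le_const2[OF tendsto_norm[OF tendsto_diff[OF tendsto_const L[of x]]]],
            intro exI allI impI)
          fix m assume "N \<le> m"
          then have "norm (X n - X m) * norm x \<le> e / 2 * norm x"
            using N n by (intro mult_right_mono) (auto intro: less_imp_le)
          then show "norm (X n x - X m x) \<le> e / 2 * norm x" using d[of n x m] by linarith
        qed
        then show "norm ((X n - Blinfun L) x) \<le> e / 2 * norm x"
          by (simp add: blinfun.bilinear_simps bounded_linear_Blinfun_apply[OF bl])
      qed (use e in simp)
      then show ?thesis using e by (simp add: dist_norm)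
    qed
    then show "\<exists>N. \<forall>n\<ge>N. dist (X n) (Blinfun L) < e" by blast
  qed
  then show "\<exists>l\<in>UNIV. X \<longlonglongrightarrow> l" by blast
qed

text \<open>This lets a fixed-point argument run inside the self-adjoint operators commuting with
  \<open>J\<close>, so that the fixed point inherits both properties.\<close>

lemma closed_self_adjoint_commuting:
  fixes J :: "'a::{real_inner, complete_space} \<Rightarrow> 'a"
  assumes "bounded_linear J"
  shows "closed {Y :: 'a \<Rightarrow>\<^sub>L 'a. norm Y \<le> a \<and> (\<forall>x y. blinfun_apply Y x \<bullet> y = x \<bullet> blinfun_apply Y y) \<and> cplx_op J Y}"
proof -
  interpret J: bounded_linear J by fact
  have "closed {Y :: 'a \<Rightarrow>\<^sub>L 'a. Y x \<bullet> y = x \<bullet> Y y}" for x y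
    by (intro closed_Collect_eq continuous_intros)
  moreover have "closed {Y :: 'a \<Rightarrow>\<^sub>L 'a. Y (J x) = J (Y x)}" for x
    by (intro closed_Collect_eq continuous_intros J.continuous_on)
  moreover have "closed {Y :: 'a \<Rightarrow>\<^sub>L 'a. norm Y \<le> a}"
    by (intro closed_Collect_le continuous_intros)
  ultimately show ?thesis
    unfolding cplx_op_def by (intro closed_Collect_conj closed_Collect_all)
qed

text \<open>With \<open>Y\<close> as below, \<open>id - Y\<close> is a square root of \<open>id - X\<close>.\<close>

lemma square_root_fixed_point:
  fixes X :: "'a::{real_inner, complete_space} \<Rightarrow>\<^sub>L 'a"
  assumes J: "bounded_linear J" and a: "0 \<le> a" "a < 1" and X: "norm X \<le> a"
    "\<And>x y. X x \<bullet> y = x \<bullet> X y" "cplx_op J X"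
  obtains Y where "norm Y \<le> a" "\<And>x y. blinfun_apply Y x \<bullet> y = x \<bullet> blinfun_apply Y y" "cplx_op J Y"
    "Y = (1/2) *\<^sub>R (X + (Y o\<^sub>L Y))"
proof -
  interpret J: bounded_linear J by fact
  define S where "S = {Y :: 'a \<Rightarrow>\<^sub>L 'a. norm Y \<le> a \<and> (\<forall>x y. blinfun_apply Y x \<bullet> y = x \<bullet> blinfun_apply Y y) \<and> cplx_op J Y}"
  define \<Phi> where "\<Phi> Y = (1/2) *\<^sub>R (X + (Y o\<^sub>L Y))" for Y :: "'a \<Rightarrow>\<^sub>L 'a"
  have "\<exists>!Y. Y \<in> S \<and> \<Phi> Y = Y"
  proof (rule Banach_fix[OF _ _ a])
    show "complete S"
      unfolding S_def
      by (rule complete_closed_subset[OF closed_self_adjoint_commuting[OF J] subset_UNIV complete_blinfun])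
    show "S \<noteq> {}" using X by (auto simp: S_def)
    show "\<Phi> ` S \<subseteq> S"
    proof safe
      fix Y assume Y: "Y \<in> S"
      have "norm (Y o\<^sub>L Y) \<le> norm Y * norm Y" by (rule norm_blinfun_compose)
      also have "\<dots> \<le> a * 1" using Y a by (intro mult_mono) (auto simp: S_def)
      finally have "norm (X + (Y o\<^sub>L Y)) \<le> a + a" using X(1) norm_triangle_ineq[of X "Y o\<^sub>L Y"] by simp
      moreover have "\<Phi> Y x \<bullet> y = x \<bullet> \<Phi> Y y" for x y
        using Y X(2)[of x y] unfolding S_def \<Phi>_def
        by (auto simp: blinfun.bilinear_simps inner_simps)
      moreover have "cplx_op J (\<Phi> Y)"
        using Y X(3) unfolding S_def \<Phi>_def cplx_op_def
        by (auto simp: blinfun.bilinear_simps J.scaleR J.add)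
      ultimately show "\<Phi> Y \<in> S" unfolding S_def by (auto simp: \<Phi>_def)
    qed
    show "dist (\<Phi> Y) (\<Phi> Z) \<le> a * dist Y Z" if Y: "Y \<in> S" and Z: "Z \<in> S" for Y Z
    proof -
      \<comment> \<open>The difference of squares is expanded in an order valid for noncommuting
        operators; as \<open>Y\<close> and \<open>Z\<close> have norm at most \<open>a\<close>, the
        Lipschitz constant is \<open>a\<close>.\<close>
      have "\<Phi> Y - \<Phi> Z = (1/2) *\<^sub>R ((Y o\<^sub>L (Y - Z)) + ((Y - Z) o\<^sub>L Z))"
        by (rule blinfun_eqI) (simp add: \<Phi>_def blinfun.bilinear_simps algebra_simps)
      then have "norm (\<Phi> Y - \<Phi> Z) \<le> (1/2) * (norm (Y o\<^sub>L (Y - Z)) + norm ((Y - Z) o\<^sub>L Z))"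
        by (simp add: norm_triangle_ineq)
      also have "\<dots> \<le> (1/2) * (norm Y * norm (Y - Z) + norm (Y - Z) * norm Z)"
        by (intro mult_left_mono add_mono norm_blinfun_compose) auto
      also have "\<dots> \<le> (1/2) * (a * norm (Y - Z) + norm (Y - Z) * a)"
        using Y Z by (intro mult_left_mono add_mono mult_right_mono) (auto simp: S_def)
      finally show "dist (\<Phi> Y) (\<Phi> Z) \<le> a * dist Y Z" by (simp add: dist_norm algebra_simps)
    qed
  qed
  then obtain Y where "Y \<in> S" "\<Phi> Y = Y" by blast
  then show ?thesis using that[of Y] by (auto simp: S_def \<Phi>_def)
qed

text \<open>The fixed point of \<open>Z = id + Y Z\<close> is the sum of the Neumann series. It is a
  right inverse at once, and injectivity of \<open>id - Y\<close> makes it a left inverse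
  too.\<close>

lemma id_minus_inverse:
  fixes Y :: "'a::{real_normed_vector, complete_space} \<Rightarrow>\<^sub>L 'a"
  assumes "norm Y < 1"
  obtains Z where "(id_blinfun - Y) o\<^sub>L Z = id_blinfun" "Z o\<^sub>L (id_blinfun - Y) = id_blinfun"
proof -
  have "\<exists>!Z. id_blinfun + (Y o\<^sub>L Z) = Z"
  proof (rule Banach_fix[OF complete_blinfun UNIV_not_empty, of "norm Y", simplified]; (intro allI)?)
    fix Z W :: "'a \<Rightarrow>\<^sub>L 'a"
    have "(Y o\<^sub>L Z) - (Y o\<^sub>L W) = Y o\<^sub>L (Z - W)" by (rule blinfun_eqI) (simp add: blinfun.bilinear_simps)
    then show "dist (id_blinfun + (Y o\<^sub>L Z)) (id_blinfun + (Y o\<^sub>L W)) \<le> norm Y * dist Z W"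
      using norm_blinfun_compose[of Y "Z - W"] by (simp add: dist_norm)
  qed (use assms in auto)
  then obtain Z where Z: "id_blinfun + (Y o\<^sub>L Z) = Z" by blast
  have app: "x + Y (Z x) = Z x" for x using arg_cong[OF Z, of "\<lambda>f. f x"] by (simp add: blinfun.bilinear_simps)
  have inj: "x = 0" if "x = Y x" for x
  proof -
    have "norm x \<le> norm Y * norm x" using norm_blinfun[of Y x] that by simp
    then have "(1 - norm Y) * norm x \<le> 0" by (simp add: algebra_simps)
    then show ?thesis using assms by (simp add: mult_le_0_iff)
  qed
  have "(id_blinfun - Y) o\<^sub>L Z = id_blinfun"
    by (rule blinfun_eqI) (metis app add_diff_cancel_right' blinfun_apply_blinfun_compose blinfun.diff_left blinfun_apply_id_blinfun)
  moreover have "Z o\<^sub>L (id_blinfun - Y) = id_blinfun"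
  proof (rule blinfun_eqI)
    fix x
    have "Z (x - Y x) - x = Y (Z (x - Y x) - x)"
      using app[of "x - Y x"] by (simp add: blinfun.bilinear_simps algebra_simps)
    then have "Z (x - Y x) - x = 0" by (rule inj)
    then show "(Z o\<^sub>L (id_blinfun - Y)) x = id_blinfun x" by (simp add: blinfun.bilinear_simps)
  qed
  ultimately show ?thesis using that by blast
qed

text \<open>The form \<open>p\<close> is represented by a self-adjoint \<open>X\<close> of norm
  below 1, and the similarity is \<open>c\<close> times a square root of \<open>id - X\<close>. The
  two bounds on \<open>q\<close> become the norm bounds for the similarity and its inverse.\<close>

lemma hilbertian_renorming:
  fixes J :: "'a::{real_inner, complete_space} \<Rightarrow> 'a" and q :: "'a \<Rightarrow> real"
  assumes J: "complex_structure J"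
    and par: "\<And>x y. q (x + y) + q (x - y) = 2 * q x + 2 * q y"
    and lower: "\<And>x. (norm x)\<^sup>2 \<le> q x" and upper: "\<And>x. q x \<le> c\<^sup>2 * (norm x)\<^sup>2"
    and qJ: "\<And>x. q (J x) = q x" and c: "c \<ge> 1"
  shows "\<exists>R Rinv. inv_pair J R Rinv \<and> norm R * norm Rinv \<le> c \<and> (\<forall>x. (norm (R x))\<^sup>2 = q x)"
proof -
  have lin: "linear J" and JJ: "\<And>x. J (J x) = - x" and nJ: "\<And>x. norm (J x) = norm x"
    using J by (auto simp: complex_structure_def)
  have blJ: "bounded_linear J"
    by (rule bounded_linear_intro[where K = 1]) (auto simp: linear_add[OF lin] linear_scale[OF lin] nJ)
  interpret J: bounded_linear J by fact
  define a where "a = 1 - 1 / c\<^sup>2"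
  have c2: "c\<^sup>2 \<ge> 1" using c by (simp add: one_le_power)
  have a: "0 \<le> a" "a < 1" using c2 by (auto simp: a_def divide_le_eq)
  define p where "p x = (norm x)\<^sup>2 - q x / c\<^sup>2" for x
  have ppar: "p (x + y) + p (x - y) = 2 * p x + 2 * p y" for x y
    
  proof -
    have "q (x + y) / c\<^sup>2 + q (x - y) / c\<^sup>2 = 2 * (q x / c\<^sup>2) + 2 * (q y / c\<^sup>2)"
      using par[of x y] by (simp flip: add_divide_distrib)
    then show ?thesis using norm_parallelogram[of x y] by (simp add: p_def)
  qed
  \<comment> \<open>The upper bound on \<open>q\<close> gives \<open>p x \<ge> 0\<close>, the lower
    bound gives the factor \<open>a\<close>.\<close>
  have pb: "\<bar>p x\<bar> \<le> a * (norm x)\<^sup>2" for x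
  proof -
    have "q x / c\<^sup>2 \<le> (norm x)\<^sup>2" using upper[of x] c2 by (simp add: divide_le_eq mult.commute)
    moreover have "(norm x)\<^sup>2 / c\<^sup>2 \<le> q x / c\<^sup>2" using lower[of x] by (intro divide_right_mono) auto
    ultimately show ?thesis by (simp add: p_def a_def algebra_simps)
  qed
  obtain X :: "'a \<Rightarrow>\<^sub>L 'a" where X: "norm X \<le> a" "\<And>x y. X x \<bullet> y = (p (x + y) - p (x - y)) / 4"
    using quadratic_form_operator[OF ppar pb a(1)] by blast
  have p0: "p 0 = 0" using ppar[of 0 0] by simp
  have pev: "p (- v) = p v" for v using ppar[of 0 v] p0 by simp
  have pJ: "p (J x) = p x" for x by (simp add: p_def nJ qJ)
  have sX: "X x \<bullet> y = x \<bullet> X y" for x y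
    using X(2)[of x y] X(2)[of y x] pev[of "x - y"] by (simp add: add.commute inner_commute)
  have Xp: "X x \<bullet> x = p x" for x using X(2)[of x x] ppar[of x x] p0 by simp
  \<comment> \<open>The polar form of \<open>p\<close> is invariant under \<open>J\<close>, and
    \<open>J\<close> is orthogonal with inverse \<open>- J\<close>.\<close>
  have JX: "cplx_op J X"
    unfolding cplx_op_def
  proof
    fix x
    have "X (J x) \<bullet> y = J (X x) \<bullet> y" for y
    proof -
      have "X (J x) \<bullet> J (- J y) = X x \<bullet> (- J y)"
        unfolding X(2) by (simp add: pJ flip: J.add J.diff J.neg)
      then have "X (J x) \<bullet> y = - (X x \<bullet> J y)" by (simp add: JJ J.neg)
      also have "\<dots> = J (X x) \<bullet> y"
        using complex_structure_inner[OF J, of "J (X x)" y] by (simp add: JJ)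
      finally show ?thesis .
    qed
    then show "X (J x) = J (X x)" using vector_eq_rdot by blast
  qed
  obtain Y :: "'a \<Rightarrow>\<^sub>L 'a" where Y: "norm Y \<le> a" "\<And>x y. Y x \<bullet> y = x \<bullet> Y y" "cplx_op J Y"
    "Y = (1/2) *\<^sub>R (X + (Y o\<^sub>L Y))"
    using square_root_fixed_point[OF blJ a X(1) sX JX] by blast
  have Ya: "2 *\<^sub>R Y x = X x + Y (Y x)" for x
    by (subst (1) Y(4)) (simp add: blinfun.bilinear_simps)
  have nRx: "(norm (c *\<^sub>R (x - Y x)))\<^sup>2 = q x" for x
  proof -
    \<comment> \<open>By the fixed-point equation,
      \<open>(id - Y)\<^sup>2 = id - 2 Y + Y\<^sup>2 = id - X\<close>.\<close>
    have "(norm (x - Y x))\<^sup>2 = (norm x)\<^sup>2 - (2 *\<^sub>R Y x) \<bullet> x + Y (Y x) \<bullet> x"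
      using Y(2)[of "Y x" x]
      by (simp add: power2_norm_eq_inner inner_diff_left inner_diff_right inner_commute)
    also have "\<dots> = q x / c\<^sup>2" unfolding Ya inner_add_left Xp by (simp add: p_def)
    finally show ?thesis using c by (simp add: power_mult_distrib)
  qed
  have "norm Y < 1" using Y(1) a by linarith
  then obtain Z where Z: "(id_blinfun - Y) o\<^sub>L Z = id_blinfun" "Z o\<^sub>L (id_blinfun - Y) = id_blinfun"
    using id_minus_inverse by blast
  define R where "R = c *\<^sub>R (id_blinfun - Y)"
  define W where "W = (1/c) *\<^sub>R Z"
  have RW: "R o\<^sub>L W = id_blinfun" "W o\<^sub>L R = id_blinfun"
    using Z c
    by (auto simp: R_def W_def bounded_bilinear.scaleR_left[OF bounded_bilinear_blinfun_compose]
        bounded_bilinear.scaleR_right[OF bounded_bilinear_blinfun_compose])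
  have Rx: "(norm (R x))\<^sup>2 = q x" for x
    using nRx[of x] by (simp add: R_def blinfun.bilinear_simps)
  have JR: "cplx_op J R" using Y(3)
    by (simp add: cplx_op_def R_def blinfun.bilinear_simps J.scaleR J.diff)
  have WR: "W (R x) = x" "R (W x) = x" for x
    using arg_cong[OF RW(1), of "\<lambda>f. f x"] arg_cong[OF RW(2), of "\<lambda>f. f x"] by auto
  have JW: "cplx_op J W" unfolding cplx_op_def
    by (metis JR WR cplx_op_def)
  have "norm R \<le> c"
  proof (rule norm_blinfun_bound)
    fix x
    have "(norm (R x))\<^sup>2 \<le> (c * norm x)\<^sup>2" using Rx upper by (simp add: power_mult_distrib)
    then show "norm (R x) \<le> c * norm x" by (rule power2_le_imp_le) (use c in simp)
  qed (use c in simp)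
  moreover have "norm W \<le> 1"
  proof (rule norm_blinfun_bound)
    fix x
    have "(norm (W x))\<^sup>2 \<le> (norm x)\<^sup>2" using Rx[of "W x"] lower[of "W x"] WR by simp
    then show "norm (W x) \<le> 1 * norm x" by simp
  qed simp
  ultimately have "norm R * norm W \<le> c * 1" using c by (intro mult_mono) auto
  then show ?thesis using RW JR JW Rx unfolding inv_pair_def by (intro exI[of _ R] exI[of _ W]) auto
qed

subsection \<open>Histories and their energies\<close>

text \<open>The energies below reduce to integrals of this kind. Continuity off a countable set
  allows for the jumps of a history at its injection times and still gives measurability.\<close>

lemma integrable_square_norm:
  fixes f :: "real \<Rightarrow> 'b::real_normed_vector"
  assumes F: "countable F" "continuous_on (- F) f" and S: "S \<in> sets borel" "S \<subseteq> {a..b}"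
    and bnd: "\<And>s. s \<in> S \<Longrightarrow> norm (f s) \<le> c"
  shows "integrable lborel (\<lambda>s. indicator S s * (norm (f s))\<^sup>2)"
proof (rule integrableI_bounded_set[where A = "{a..b}" and B = "c\<^sup>2"])
  have "(\<lambda>s. (norm (f s))\<^sup>2) \<in> borel_measurable borel"
    by (rule borel_measurable_continuous_countable_exceptions[OF F(1)]) (intro continuous_intros F(2))
  then show "(\<lambda>s. indicator S s * (norm (f s))\<^sup>2) \<in> borel_measurable lborel"
    using S(1) by simp
  show "AE s in lborel. s \<in> {a..b} \<longrightarrow> norm (indicator S s * (norm (f s))\<^sup>2) \<le> c\<^sup>2"
    using bnd by (auto simp: indicator_def intro!: power_mono)
  show "AE s in lborel. s \<notin> {a..b} \<longrightarrow> indicator S s * (norm (f s))\<^sup>2 = 0"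
    using S(2) by (auto simp: indicator_def simp del: atLeastAtMost_iff)
qed (simp_all add: emeasure_lborel_Icc_eq)

lemma integral_lborel_translate:
  fixes f :: "real \<Rightarrow> real"
  shows "(\<integral>s. f (s + r) \<partial>lborel) = (\<integral>s. f s \<partial>lborel)"
  using lborel_integral_real_affine[of 1 f r] by (simp add: add.commute)

lemma integrable_lborel_translate:
  fixes f :: "real \<Rightarrow> real"
  assumes "integrable lborel f"
  shows "integrable lborel (\<lambda>s. f (s + r))"
  using lborel_integrable_real_affine[OF assms, of 1 r] by (simp add: add.commute)

text \<open>Young's inequality; the weight \<open>p\<close> stays free so that the two energies can
  be balanced later.\<close>

lemma weighted_square_sum:
  fixes a b p :: real
  assumes "p > 0"
  shows "(a + b)\<^sup>2 \<le> (1 + p) * a\<^sup>2 + (1 + 1 / p) * b\<^sup>2"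
proof -
  have "0 \<le> (p * a - b)\<^sup>2 / p" using assms by simp
  also have "\<dots> = (1 + p) * a\<^sup>2 + (1 + 1 / p) * b\<^sup>2 - (a + b)\<^sup>2"
    using assms by (simp add: power2_eq_square field_simps)
  finally show ?thesis by simp
qed

text \<open>Two similarities are fixed here, and infima over them are taken only at the end. The
  averaging window \<open>m\<close> and the bound \<open>M\<close> are parameters, later set to
  \<open>min 1 tau\<close> and to the supremum.\<close>

locale similar_semigroup =
  fixes J :: "'a::{real_inner, complete_space} \<Rightarrow> 'a"
    and T :: "real \<Rightarrow> 'a \<Rightarrow>\<^sub>L 'a" and lam tau m M :: real and R1 W1 R2 W2 :: "'a \<Rightarrow>\<^sub>L 'a"
  assumes J: "complex_structure J" and C0: "C0_semigroup J T"
    and lam: "lam > 0" and m: "0 < m" "m \<le> tau"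
    and inv1: "inv_pair J R1 W1"
    and contr1: "\<And>t. t \<ge> 0 \<Longrightarrow> norm (R1 o\<^sub>L (exp (- lam * t) *\<^sub>R T t) o\<^sub>L W1) \<le> 1"
    and inv2: "inv_pair J R2 W2" and contr2: "norm (R2 o\<^sub>L T tau o\<^sub>L W2) \<le> 1"
    and M: "\<And>t. 0 \<le> t \<Longrightarrow> t \<le> tau \<Longrightarrow> norm (T t) \<le> M"
begin

section \<open>Contractivity, growth and continuity of the orbits\<close>

lemma tau: "tau > 0" using m by simp

lemma J_simps: "J (x + y) = J x + J y" "J (x - y) = J x - J y" "J (c *\<^sub>R x) = c *\<^sub>R J x"
  "J (J x) = - x" "norm (J x) = norm x" "J 0 = 0"
  using J by (auto simp: complex_structure_def linear_add linear_diff linear_scale linear_0)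

lemma bounded_linear_J: "bounded_linear J"
  by (rule bounded_linear_intro[where K = 1]) (simp_all add: J_simps)

lemma R_simps [simp]: "W1 (R1 x) = x" "R1 (W1 x) = x" "W2 (R2 x) = x" "R2 (W2 x) = x"
proof -
  have "W1 o\<^sub>L R1 = id_blinfun" "R1 o\<^sub>L W1 = id_blinfun" "W2 o\<^sub>L R2 = id_blinfun" "R2 o\<^sub>L W2 = id_blinfun"
    using inv1 inv2 by (auto simp: inv_pair_def)
  from this[THEN arg_cong[where f = "\<lambda>f. blinfun_apply f x"]]
  show "W1 (R1 x) = x" "R1 (W1 x) = x" "W2 (R2 x) = x" "R2 (W2 x) = x" by simp_all
qed

lemma J_R: "R1 (J x) = J (R1 x)" "R2 (J x) = J (R2 x)"
  using inv1 inv2 by (auto simp: inv_pair_def cplx_op_def)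

lemma T_simps: "T 0 x = x" "t \<ge> 0 \<Longrightarrow> T t (J x) = J (T t x)"
  using C0 by (auto simp: C0_semigroup_def cplx_op_def)

lemma T_add: "s \<ge> 0 \<Longrightarrow> t \<ge> 0 \<Longrightarrow> T (s + t) x = T s (T t x)"
  using C0 by (auto simp: C0_semigroup_def)

lemma R1_contraction:
  assumes "t \<ge> 0"
  shows "norm (exp (- lam * t) *\<^sub>R R1 (T t x)) \<le> norm (R1 x)"
proof -
  have "norm ((R1 o\<^sub>L (exp (- lam * t) *\<^sub>R T t) o\<^sub>L W1) (R1 x)) \<le> 1 * norm (R1 x)"
    using norm_blinfun mult_right_mono[OF contr1[OF assms] norm_ge_zero] by (rule order_trans)
  then show ?thesis by (simp add: blinfun.bilinear_simps)
qed

lemma R2_contraction: "norm (R2 (T tau x)) \<le> norm (R2 x)"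
proof -
  have "norm ((R2 o\<^sub>L T tau o\<^sub>L W2) (R2 x)) \<le> 1 * norm (R2 x)"
    using norm_blinfun mult_right_mono[OF contr2 norm_ge_zero] by (rule order_trans)
  then show ?thesis by simp
qed

lemma norm_W1: "norm x \<le> norm W1 * norm (R1 x)"
  using norm_blinfun[of W1 "R1 x"] by simp

lemma norm_W2: "norm x \<le> norm W2 * norm (R2 x)"
  using norm_blinfun[of W2 "R2 x"] by simp

text \<open>Undoing the first similarity costs its condition number and the factor
  \<open>exp (lam * t)\<close>, here made uniform over \<open>[0, u]\<close>.\<close>

lemma T_growth:
  assumes "0 \<le> t" "t \<le> u"
  shows "norm (T t x) \<le> norm W1 * norm R1 * exp (lam * u) * norm x"
proof -
  have "exp (- lam * t) * norm (T t x) \<le> norm W1 * (exp (- lam * t) * norm (R1 (T t x)))"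
    using mult_left_mono[OF norm_W1[of "T t x"], of "exp (- lam * t)"] by (simp add: algebra_simps)
  also have "\<dots> \<le> norm W1 * (norm R1 * norm x)"
    using R1_contraction[OF assms(1), of x] norm_blinfun[of R1 x] by (intro mult_left_mono) auto
  finally have "exp (lam * t) * (exp (- lam * t) * norm (T t x)) \<le> exp (lam * t) * (norm W1 * (norm R1 * norm x))"
    by (intro mult_left_mono) auto
  then have "norm (T t x) \<le> exp (lam * t) * (norm W1 * (norm R1 * norm x))"
    by (simp flip: mult.assoc exp_add)
  also have "\<dots> \<le> exp (lam * u) * (norm W1 * (norm R1 * norm x))"
    using assms lam by (intro mult_right_mono) auto
  finally show ?thesis by (simp add: algebra_simps)
qed

text \<open>Right continuity at 0 spreads to both sides of every time: an increment of length
  \<open>h\<close> is \<open>T u\<close> applied to \<open>T h x - x\<close>, with \<open>u\<close>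
  the smaller time, and \<open>T u\<close> is locally uniformly bounded.\<close>

lemma continuous_on_T: "continuous_on {0..} (\<lambda>t. T t x)"
  unfolding continuous_on_iff
proof (intro ballI allI impI)
  fix t e :: real assume t: "t \<in> {0..}" and e: "e > 0"
  define K where "K = norm W1 * norm R1 * exp (lam * (t + 1))"
  have K: "K \<ge> 0" by (simp add: K_def)
  have "((\<lambda>h. T h x) \<longlongrightarrow> x) (at_right 0)" using C0 by (simp add: C0_semigroup_def)
  then have "eventually (\<lambda>h. dist (T h x) x < e / (K + 1)) (at_right 0)"
    by (rule tendstoD) (use e K in simp)
  then obtain d where d: "d > 0" "\<And>h. 0 < h \<Longrightarrow> h < d \<Longrightarrow> dist (T h x) x < e / (K + 1)"
    unfolding eventually_at_right_field by auto
  have key: "norm (T u (T h x) - T u x) < e" if "0 \<le> u" "u \<le> t + 1" "0 \<le> h" "h < d" for u h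
  proof (cases "h = 0")
    case True then show ?thesis using e by (simp add: T_simps)
  next
    case False
    have "norm (T u (T h x) - T u x) \<le> K * norm (T h x - x)"
      using T_growth[OF that(1,2), of "T h x - x"] by (simp add: blinfun.bilinear_simps K_def)
    also have "\<dots> \<le> (K + 1) * norm (T h x - x)" by (intro mult_right_mono) auto
    also have "\<dots> < e" using d(2)[of h] that False K by (simp add: dist_norm less_divide_eq mult.commute)
    finally show ?thesis .
  qed
  have "dist (T t' x) (T t x) < e" if t': "t' \<in> {0..}" "dist t' t < min d 1" for t'
  proof (cases "t \<le> t'")
    case True
    then show ?thesis using key[of t "t' - t"] T_add[of t "t' - t" x] t t' by (simp add: dist_norm)
  next
    case False
    then show ?thesis using key[of t' "t - t'"] T_add[of t' "t - t'" x] t t'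
      by (simp add: dist_norm norm_minus_commute)
  qed
  then show "\<exists>d>0. \<forall>t'\<in>{0..}. dist t' t < d \<longrightarrow> dist (T t' x) (T t x) < e"
    using d(1) by (intro exI[of _ "min d 1"]) auto
qed

text \<open>The increment splits into \<open>T\<close> applied to \<open>f s - f s0\<close>, small
  by local boundedness, and an increment of one orbit, small by strong continuity. The truncation
  keeps times nonnegative.\<close>

lemma continuous_on_T_apply:
  fixes f :: "real \<Rightarrow> 'a"
  assumes "continuous_on S f"
  shows "continuous_on S (\<lambda>s. T (max 0 s) (f s))"
  unfolding continuous_on_def
proof
  fix s0 assume s0: "s0 \<in> S"
  define K where "K = norm W1 * norm R1 * exp (lam * (max 0 s0 + 1))"
  have f: "(f \<longlongrightarrow> f s0) (at s0 within S)" using assms s0 by (simp add: continuous_on_def)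
  have id: "((\<lambda>s. max 0 s) \<longlongrightarrow> max 0 s0) (at s0 within S)" by (intro tendsto_intros)
  have "((\<lambda>s. T (max 0 s) (f s - f s0)) \<longlongrightarrow> 0) (at s0 within S)"
  proof (rule Lim_null_comparison)
    have "eventually (\<lambda>s. max 0 s < max 0 s0 + 1) (at s0 within S)"
      using order_tendstoD(2)[OF id, of "max 0 s0 + 1"] by (simp del: max_less_iff_conj)
    then show "eventually (\<lambda>s. norm (T (max 0 s) (f s - f s0)) \<le> K * norm (f s - f s0)) (at s0 within S)"
    proof eventually_elim
      case (elim s)
      then show ?case unfolding K_def by (intro T_growth) auto
    qed
    have "((\<lambda>s. K * norm (f s - f s0)) \<longlongrightarrow> K * norm (f s0 - f s0)) (at s0 within S)"
      by (intro tendsto_intros f)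
    then show "((\<lambda>s. K * norm (f s - f s0)) \<longlongrightarrow> 0) (at s0 within S)" by simp
  qed
  moreover have "((\<lambda>s. T (max 0 s) (f s0)) \<longlongrightarrow> T (max 0 s0) (f s0)) (at s0 within S)"
  proof -
    have "continuous_on S (\<lambda>s. T (max 0 s) (f s0))"
      by (rule continuous_on_compose2[OF continuous_on_T]) (auto intro!: continuous_intros)
    then show ?thesis using s0 by (simp add: continuous_on_def)
  qed
  ultimately have "((\<lambda>s. T (max 0 s) (f s - f s0) + T (max 0 s) (f s0)) \<longlongrightarrow> 0 + T (max 0 s0) (f s0)) (at s0 within S)"
    by (rule tendsto_add)
  then show "((\<lambda>s. T (max 0 s) (f s)) \<longlongrightarrow> T (max 0 s0) (f s0)) (at s0 within S)"
    by (simp add: blinfun.bilinear_simps)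
qed

text \<open>A history \<open>G\<close> describes states injected in the past: if \<open>x\<^sub>i\<close> was injected at time \<open>- t\<^sub>i\<close>, then
  \<open>G s\<close> is the state reached at time \<open>- s\<close>, that is, the sum of the \<open>T (t\<^sub>i - s) x\<^sub>i\<close> with \<open>t\<^sub>i \<ge> s\<close>.
  The present state is \<open>G 0\<close>, and letting time \<open>r\<close> pass turns \<open>G\<close> into \<open>\<lambda>s. G (s - r)\<close>.\<close>

definition E :: "(real \<Rightarrow> 'a) set" where
  "E = {G. (\<forall>s\<le>0. G s = T (- s) (G 0)) \<and> (\<exists>L. \<forall>s>L. G s = 0) \<and>
    (\<exists>F. countable F \<and> continuous_on (- F) G) \<and> (\<forall>a. \<exists>b. \<forall>s\<ge>a. norm (G s) \<le> b)}"

lemma E_past: "G \<in> E \<Longrightarrow> s \<le> 0 \<Longrightarrow> G s = T (- s) (G 0)"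
  unfolding E_def by blast

lemma E_add:
  assumes "G \<in> E" "H \<in> E"
  shows "(\<lambda>s. G s + H s) \<in> E"
proof -
  obtain L L' where L: "\<forall>s>L. G s = 0" "\<forall>s>L'. H s = 0" using assms by (auto simp: E_def)
  obtain F F' where F: "countable F" "continuous_on (- F) G" "countable F'" "continuous_on (- F') H"
    using assms by (auto simp: E_def)
  have "\<exists>b. \<forall>s\<ge>a. norm (G s + H s) \<le> b" for a
  proof -
    obtain b b' where "\<forall>s\<ge>a. norm (G s) \<le> b" "\<forall>s\<ge>a. norm (H s) \<le> b'"
      using assms unfolding E_def by blast
    then show ?thesis by (intro exI[of _ "b + b'"]) (auto intro: norm_triangle_mono)
  qed
  moreover have "\<exists>F. countable F \<and> continuous_on (- F) (\<lambda>s. G s + H s)"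
    using F by (intro exI[of _ "F \<union> F'"]) (auto intro!: continuous_on_add elim: continuous_on_subset)
  moreover have "\<exists>L. \<forall>s>L. G s + H s = 0" using L by (intro exI[of _ "max L L'"]) auto
  moreover have "\<forall>s\<le>0. G s + H s = T (- s) (G 0 + H 0)"
    by (metis E_past assms blinfun.add_right)
  ultimately show ?thesis unfolding E_def by blast
qed

lemma E_linear:
  assumes G: "G \<in> E" and h: "bounded_linear h" and comm: "\<And>t x. t \<ge> 0 \<Longrightarrow> T t (h x) = h (T t x)"
  shows "(\<lambda>s. h (G s)) \<in> E"
proof -
  interpret h: bounded_linear h by fact
  obtain K where K: "\<And>x. norm (h x) \<le> norm x * K" "K > 0" using h.pos_bounded by blast
  obtain L where L: "\<forall>s>L. G s = 0" using assms by (auto simp: E_def)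
  obtain F where F: "countable F" "continuous_on (- F) G"
    using assms by (auto simp: E_def)
  have "\<exists>b. \<forall>s\<ge>a. norm (h (G s)) \<le> b" for a
  proof -
    obtain b where "\<forall>s\<ge>a. norm (G s) \<le> b" using G unfolding E_def by blast
    then show ?thesis
      by (intro exI[of _ "b * K"] allI impI order_trans[OF K(1)] mult_right_mono)
        (use K(2) in \<open>auto intro: less_imp_le\<close>)
  qed
  moreover have "\<exists>F. countable F \<and> continuous_on (- F) (\<lambda>s. h (G s))"
    using F by (auto intro!: h.continuous_on)
  moreover have "\<exists>L. \<forall>s>L. h (G s) = 0" by (intro exI[of _ L]) (use L h.zero in auto)
  moreover have "\<forall>s\<le>0. h (G s) = T (- s) (h (G 0))"
    by (metis E_past[OF G] comm neg_0_le_iff_le)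
  ultimately show ?thesis unfolding E_def by blast
qed

lemma E_scale: "G \<in> E \<Longrightarrow> (\<lambda>s. c *\<^sub>R G s) \<in> E"
  by (rule E_linear) (auto intro: bounded_linear_intros simp: blinfun.bilinear_simps)

lemma E_J: "G \<in> E \<Longrightarrow> (\<lambda>s. J (G s)) \<in> E"
  by (rule E_linear) (auto intro: bounded_linear_J simp: T_simps)

lemma E_diff:
  assumes "G \<in> E" "H \<in> E"
  shows "(\<lambda>s. G s - H s) \<in> E"
  using E_add[OF assms(1) E_scale[OF assms(2), of "-1"]] by simp

lemma continuous_on_translate:
  fixes G :: "real \<Rightarrow> 'a"
  assumes "countable F" "continuous_on (- F) G"
  shows "countable ((\<lambda>s. s - r) ` F)" "continuous_on (- (\<lambda>s. s - r) ` F) (\<lambda>s. G (s + r))"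
proof -
  show "countable ((\<lambda>s. s - r) ` F)" using assms(1) by simp
  have "s \<in> - (\<lambda>s. s - r) ` F \<Longrightarrow> s + r \<notin> F" for s
    by (metis ComplD add_diff_cancel_right' image_eqI)
  then show "continuous_on (- (\<lambda>s. s - r) ` F) (\<lambda>s. G (s + r))"
    by (intro continuous_on_compose2[OF assms(2)] continuous_intros) blast
qed

lemma E_shift:
  assumes G: "G \<in> E" and r: "r \<ge> 0"
  shows "(\<lambda>s. G (s - r)) \<in> E"
proof -
  obtain L where L: "\<forall>s>L. G s = 0" using assms by (auto simp: E_def)
  obtain F where F: "countable F" "continuous_on (- F) G"
    using assms by (auto simp: E_def)
  have "\<exists>b. \<forall>s\<ge>a. norm (G (s - r)) \<le> b" for a
  proof -
    obtain b where "\<forall>s\<ge>a - r. norm (G s) \<le> b" using G unfolding E_def by blast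
    then show ?thesis by (intro exI[of _ b]) auto
  qed
  moreover have "\<exists>F. countable F \<and> continuous_on (- F) (\<lambda>s. G (s - r))"
    using continuous_on_translate[OF F, of "- r"] by auto
  moreover have "\<exists>L. \<forall>s>L. G (s - r) = 0" using L by (intro exI[of _ "L + r"]) auto
  moreover have "\<forall>s\<le>0. G (s - r) = T (- s) (G (0 - r))"
  proof (intro allI impI)
    fix s :: real assume "s \<le> 0"
    then show "G (s - r) = T (- s) (G (0 - r))"
      using E_past[OF G, of "s - r"] E_past[OF G, of "- r"] T_add[of "- s" r "G 0"] r
      by (simp add: add.commute)
  qed
  ultimately show ?thesis unfolding E_def by simp
qed

text \<open>The history of a single injection of \<open>x\<close> at time 0. It shows that every
  vector has a history, and its energy bounds the quotient norm from above.\<close>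

definition start :: "'a \<Rightarrow> real \<Rightarrow> 'a" where
  "start x s = (if s \<le> 0 then T (- s) x else 0)"

lemma start_0 [simp]: "start x 0 = x" by (simp add: start_def T_simps)

lemma start_in_E: "start x \<in> E"
proof -
  have "\<exists>b. \<forall>s\<ge>a. norm (start x s) \<le> b" for a
    using T_growth[of "- s" "max 0 (- a)" x for s]
    by (intro exI[of _ "norm W1 * norm R1 * exp (lam * max 0 (- a)) * norm x"]) (auto simp: start_def)
  moreover have "continuous_on (- {0}) (start x)"
  proof -
    have "continuous_on ({..<0} \<union> {0<..}) (start x)"
    proof (rule continuous_on_open_Un)
      have "continuous_on {..<0} (\<lambda>s. T (- s) x)"
        by (rule continuous_on_compose2[OF continuous_on_T]) (auto intro!: continuous_intros)
      then show "continuous_on {..<0} (start x)"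
        by (rule continuous_on_eq) (simp add: start_def)
      show "continuous_on {0<..} (start x)"
        by (rule continuous_on_eq[of _ "\<lambda>_. 0"]) (auto simp: start_def)
    qed auto
    moreover have "- {0 :: real} = {..<0} \<union> {0<..}" by auto
    ultimately show ?thesis by simp
  qed
  then have "\<exists>F. countable F \<and> continuous_on (- F) (start x)" by (intro exI[of _ "{0}"]) simp
  moreover have "\<exists>L. \<forall>s>L. start x s = 0" by (intro exI[of _ 0]) (simp add: start_def)
  moreover have "\<forall>s\<le>0. start x s = T (- s) (start x 0)" by (simp add: start_def T_simps)
  ultimately show ?thesis unfolding E_def by blast
qed

text \<open>\<open>G 0 - T s (G s)\<close> is the contribution to the present of what was injected during the last \<open>s\<close>
  time units. The sum \<open>n2 + n3\<close> is the squared norm in the Schaeffer isometric dilation of the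
  contraction \<open>R2 T(tau) R2\<^sup>-\<^sup>1\<close>, written out along the lattices \<open>\<theta> + tau \<int>\<close> and integrated over
  \<open>\<theta>\<close>; the second summand of \<open>n2\<close>, the norm of the latest injection, is added in order to control
  the state at the last lattice point before the present.\<close>

definition n1 :: "(real \<Rightarrow> 'a) \<Rightarrow> real \<Rightarrow> real" where
  "n1 G s = indicator {0<..m} s * (norm (exp (- lam * s) *\<^sub>R R1 (G 0 - T s (G s))))\<^sup>2"

definition n2 :: "(real \<Rightarrow> 'a) \<Rightarrow> real \<Rightarrow> real" where
  "n2 G s = indicator {- tau<..0} s * (norm (R2 (G s)))\<^sup>2
     + indicator {- tau<..0} s * (norm (R2 (G s - T tau (G (s + tau)))))\<^sup>2"

definition n3 :: "(real \<Rightarrow> 'a) \<Rightarrow> real \<Rightarrow> real" where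
  "n3 G s = indicator {0<..} s * (norm (R2 (G s)))\<^sup>2 - indicator {0<..} s * (norm (R2 (T tau (G s))))\<^sup>2"

text \<open>For \<open>n3\<close> this is the contractivity of \<open>T tau\<close> in the norm
  given by \<open>R2\<close>.\<close>

lemma n_nonneg: "n1 G s \<ge> 0" "n2 G s \<ge> 0" "n3 G s \<ge> 0"
  using power_mono[OF R2_contraction[of "G s"], of 2] by (auto simp: n1_def n2_def n3_def indicator_def)

section \<open>Integrability of the energy densities\<close>

lemma integrable_E:
  fixes A :: "'a \<Rightarrow>\<^sub>L 'a"
  assumes G: "G \<in> E" and S: "S \<in> sets borel" "S \<subseteq> {a..b}"
  shows "integrable lborel (\<lambda>s. indicator S s * (norm (A (G s)))\<^sup>2)"
proof -
  obtain F where F: "countable F" "continuous_on (- F) G"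
    using assms by (auto simp: E_def)
  obtain c where c: "\<forall>s\<ge>a. norm (G s) \<le> c" using G unfolding E_def by blast
  show ?thesis
  proof (rule integrable_square_norm[OF F(1) _ S])
    show "continuous_on (- F) (\<lambda>s. A (G s))" by (intro continuous_intros F)
    fix s assume "s \<in> S"
    then have "norm (G s) \<le> c" using S c by auto
    then show "norm (A (G s)) \<le> norm A * c"
      using norm_blinfun[of A "G s"] mult_left_mono[of "norm (G s)" c "norm A"] by simp
  qed
qed

lemma integrable_n1:
  assumes G: "G \<in> E"
  shows "integrable lborel (n1 G)"
proof -
  obtain F where F: "countable F" "continuous_on (- F) G"
    using assms by (auto simp: E_def)
  obtain c where c: "\<forall>s\<ge>0. norm (G s) \<le> c" using G unfolding E_def by blast
  have K: "norm W1 * norm R1 * exp (lam * m) \<ge> 0" by simp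
  \<comment> \<open>Replacing \<open>s\<close> by \<open>max 0 s\<close> changes nothing on
    \<open>(0, m]\<close> and makes the vector inside the norm continuous off \<open>F\<close> on
    the whole line.\<close>
  have "integrable lborel (\<lambda>s. indicator {0<..m} s * (norm (exp (- lam * s) *\<^sub>R R1 (G 0 - T (max 0 s) (G s))))\<^sup>2)"
  proof (rule integrable_square_norm[OF F(1), where a = 0 and b = m])
    show "continuous_on (- F) (\<lambda>s. exp (- lam * s) *\<^sub>R R1 (G 0 - T (max 0 s) (G s)))"
      by (intro continuous_intros continuous_on_T_apply F)
    fix s assume s: "s \<in> {0<..m}"
    have "norm (exp (- lam * s) *\<^sub>R R1 (G 0 - T (max 0 s) (G s))) \<le> norm (R1 (G 0 - T s (G s)))"
      using s lam by (auto intro!: mult_left_le_one_le)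
    also have "\<dots> \<le> norm R1 * norm (G 0 - T s (G s))" by (rule norm_blinfun)
    also have "\<dots> \<le> norm R1 * (norm (G 0) + norm (T s (G s)))"
      by (intro mult_left_mono norm_triangle_ineq4) auto
    also have "\<dots> \<le> norm R1 * (c + norm W1 * norm R1 * exp (lam * m) * c)"
      using s c T_growth[of s m "G s"] mult_left_mono[OF _ K, of "norm (G s)" c]
      by (intro mult_left_mono add_mono) fastforce+
    finally show "norm (exp (- lam * s) *\<^sub>R R1 (G 0 - T (max 0 s) (G s))) \<le> \<dots>" .
  qed auto
  moreover have "n1 G = (\<lambda>s. indicator {0<..m} s * (norm (exp (- lam * s) *\<^sub>R R1 (G 0 - T (max 0 s) (G s))))\<^sup>2)"
    by (auto simp: n1_def indicator_def)
  ultimately show ?thesis by simp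
qed

lemma integrable_n2:
  assumes G: "G \<in> E"
  shows "integrable lborel (n2 G)"
proof -
  obtain F where F: "countable F" "continuous_on (- F) G"
    using assms by (auto simp: E_def)
  obtain c where c: "\<forall>s\<ge>-tau. norm (G s) \<le> c" using G unfolding E_def by blast
  note F' = continuous_on_translate[OF F, of tau]
  have "integrable lborel (\<lambda>s. indicator {- tau<..0} s * (norm (R2 (G s - T tau (G (s + tau)))))\<^sup>2)"
  \<comment> \<open>\<open>G\<close> enters both at \<open>s\<close> and at \<open>s + tau\<close>,
    so the exceptional set is joined with its translate.\<close>
  proof (rule integrable_square_norm[where F = "F \<union> (\<lambda>s. s - tau) ` F" and a = "- tau" and b = 0])
    show "countable (F \<union> (\<lambda>s. s - tau) ` F)" using F F' by auto
    show "continuous_on (- (F \<union> (\<lambda>s. s - tau) ` F)) (\<lambda>s. R2 (G s - T tau (G (s + tau))))"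
      using continuous_on_subset[OF F(2)] continuous_on_subset[OF F'(2)]
      by (intro continuous_intros) auto
    fix s assume s: "s \<in> {- tau<..0}"
    have "norm (R2 (G s - T tau (G (s + tau)))) \<le> norm R2 * norm (G s - T tau (G (s + tau)))" by (rule norm_blinfun)
    also have "\<dots> \<le> norm R2 * (norm (G s) + norm (T tau (G (s + tau))))"
      by (intro mult_left_mono norm_triangle_ineq4) auto
    also have "\<dots> \<le> norm R2 * (c + norm (T tau) * c)"
      using s c norm_blinfun[of "T tau" "G (s + tau)"] mult_left_mono[of "norm (G (s + tau))" c "norm (T tau)"] tau
      by (intro mult_left_mono add_mono) fastforce+
    finally show "norm (R2 (G s - T tau (G (s + tau)))) \<le> \<dots>" .
  qed auto
  moreover have "integrable lborel (\<lambda>s. indicator {- tau<..0} s * (norm (R2 (G s)))\<^sup>2)"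
    by (rule integrable_E[OF G, where a = "- tau" and b = 0]) auto
  ultimately show ?thesis unfolding n2_def[abs_def] by (intro Bochner_Integration.integrable_add)
qed

lemma integrable_n3:
  assumes G: "G \<in> E"
  shows "integrable lborel (n3 G)"
proof -
  obtain L where L: "\<forall>s>L. G s = 0" using assms by (auto simp: E_def)
  have "n3 G = (\<lambda>s. indicator {0<..L} s * (norm (R2 (G s)))\<^sup>2 - indicator {0<..L} s * (norm ((R2 o\<^sub>L T tau) (G s)))\<^sup>2)"
    using L by (auto simp: n3_def indicator_def not_le)
  moreover have "integrable lborel (\<lambda>s. indicator {0<..L} s * (norm (A (G s)))\<^sup>2)" for A :: "'a \<Rightarrow>\<^sub>L 'a"
    by (rule integrable_E[OF G, where a = 0 and b = L]) auto
  ultimately show ?thesis by (simp only:) (intro Bochner_Integration.integrable_diff)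
qed

section \<open>Total energies under the passage of time\<close>

definition I1 :: "(real \<Rightarrow> 'a) \<Rightarrow> real" where "I1 G = (\<integral>s. n1 G s \<partial>lborel)"

definition I2 :: "(real \<Rightarrow> 'a) \<Rightarrow> real" where "I2 G = (\<integral>s. n2 G s + n3 G s \<partial>lborel)"

lemma I_nonneg: "I1 G \<ge> 0" "I2 G \<ge> 0"
  by (auto simp: I1_def I2_def intro!: Bochner_Integration.integral_nonneg add_nonneg_nonneg n_nonneg)

lemma integrable_n23: "G \<in> E \<Longrightarrow> integrable lborel (\<lambda>s. n2 G s + n3 G s)"
  using integrable_n2 integrable_n3 by (intro Bochner_Integration.integrable_add)

text \<open>The new density at \<open>s + r\<close> is compared with the old one at
  \<open>s\<close>. For \<open>s > 0\<close> the recent contribution is carried forward by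
  \<open>T r\<close>, and the extra weight \<open>exp (- lam * r)\<close> makes this contractive in
  the norm given by \<open>R1\<close>.\<close>

lemma I1_shift:
  assumes G: "G \<in> E" and r: "r \<ge> 0"
  shows "I1 (\<lambda>s. G (s - r)) \<le> I1 G"
proof -
  have "n1 (\<lambda>s. G (s - r)) (s + r) \<le> n1 G s" for s
  proof (cases "s > 0 \<and> s + r \<le> m")
    case True
    have "G (- r) - T (s + r) (G s) = T r (G 0 - T s (G s))"
      using E_past[OF G, of "- r"] T_add[of r s "G s"] True r by (simp add: blinfun.bilinear_simps add.commute)
    moreover have "exp (- lam * (s + r)) = exp (- lam * s) * exp (- lam * r)"
      by (simp add: algebra_simps flip: exp_add)
    ultimately have "norm (exp (- lam * (s + r)) *\<^sub>R R1 (G (- r) - T (s + r) (G s)))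
        = exp (- lam * s) * norm (exp (- lam * r) *\<^sub>R R1 (T r (G 0 - T s (G s))))"
      by (simp only: norm_scaleR) simp
    also have "\<dots> \<le> exp (- lam * s) * norm (R1 (G 0 - T s (G s)))"
      by (intro mult_left_mono R1_contraction r) auto
    finally show ?thesis using True r unfolding n1_def by (simp add: power_mono)
  next
    case False
    have "n1 (\<lambda>s. G (s - r)) (s + r) = 0"
    proof (cases "s \<le> 0 \<and> 0 < s + r")
      case True
      \<comment> \<open>Here only the free orbit is seen: nothing was injected during the last
        \<open>s + r\<close> units of the shifted history.\<close>
      have "G (- r) - T (s + r) (G s) = 0"
        using E_past[OF G, of "- r"] E_past[OF G, of s] T_add[of "s + r" "- s" "G 0"] True r by simp
      then show ?thesis by (simp add: n1_def)
    qed (use False in \<open>auto simp: n1_def indicator_def\<close>)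
    then show ?thesis using n_nonneg by simp
  qed
  then have "(\<integral>s. n1 (\<lambda>s. G (s - r)) (s + r) \<partial>lborel) \<le> I1 G"
    unfolding I1_def by (intro integral_mono integrable_lborel_translate integrable_n1 E_shift G r)
  then show ?thesis by (simp add: I1_def integral_lborel_translate)
qed

text \<open>Up to the telescoping term \<open>z s - z (s - tau)\<close>, which integrates to zero, the shift decreases
  the energy density pointwise.\<close>

lemma I2_shift:
  assumes G: "G \<in> E" and r: "r \<ge> 0"
  shows "I2 (\<lambda>s. G (s - r)) \<le> I2 G"
proof -
  define z where "z s = indicator {- tau - r<..- tau} s * (norm (R2 (G s)))\<^sup>2" for s
  have z: "integrable lborel z"
    unfolding z_def[abs_def] by (rule integrable_E[OF G, where a = "- tau - r" and b = "- tau"]) auto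
  have "n2 (\<lambda>s. G (s - r)) (s + r) + n3 (\<lambda>s. G (s - r)) (s + r) \<le> n2 G s + n3 G s + (z s - z (s + - tau))" for s
  proof -
    define A where "A = (norm (R2 (G s)))\<^sup>2"
    define Y where "Y = (norm (R2 (G s - T tau (G (s + tau)))))\<^sup>2"
    define C where "C = (norm (R2 (T tau (G s))))\<^sup>2"
    define B where "B = (norm (R2 (G (s - tau))))\<^sup>2"
    \<comment> \<open>At nonpositive times the history is a free orbit, so one lattice step is
      exactly \<open>T tau\<close>; for the same reason the injection term \<open>Y\<close> vanishes
      up to \<open>- tau\<close>.\<close>
    have B: "B = C" if "s \<le> 0"
      using E_past[OF G, of s] E_past[OF G, of "s - tau"] T_add[of tau "- s" "G 0"] that tau
      by (simp add: B_def C_def)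
    have Y: "Y = 0" if "s \<le> - tau"
      using E_past[OF G, of s] E_past[OF G, of "s + tau"] T_add[of tau "- s - tau" "G 0"] that tau
      by (simp add: Y_def)
    have "Y \<ge> 0" by (simp add: Y_def)
    have eqs: "n2 (\<lambda>s. G (s - r)) (s + r) + n3 (\<lambda>s. G (s - r)) (s + r)
        = indicator {- tau<..0} (s + r) * A + indicator {- tau<..0} (s + r) * Y
          + (indicator {0<..} (s + r) * A - indicator {0<..} (s + r) * C)"
      "n2 G s + n3 G s = indicator {- tau<..0} s * A + indicator {- tau<..0} s * Y
          + (indicator {0<..} s * A - indicator {0<..} s * C)"
      "z s = indicator {- tau - r<..- tau} s * A" "z (s + - tau) = indicator {- tau - r<..- tau} (s - tau) * B"
      by (simp_all add: n2_def n3_def z_def A_def Y_def C_def B_def add.commute add.left_commute)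
    \<comment> \<open>The terms in \<open>A\<close>, \<open>B\<close> and \<open>C\<close> cancel
      exactly. The new window for \<open>Y\<close> leaves the old one only at
      \<open>s \<le> - tau\<close>, where \<open>Y = 0\<close>.\<close>
    show ?thesis
      unfolding eqs using \<open>Y \<ge> 0\<close> B Y r tau by (auto simp: indicator_def)
  qed
  then have "(\<integral>s. n2 (\<lambda>s. G (s - r)) (s + r) + n3 (\<lambda>s. G (s - r)) (s + r) \<partial>lborel)
      \<le> (\<integral>s. n2 G s + n3 G s + (z s - z (s + - tau)) \<partial>lborel)"
    by (intro integral_mono integrable_lborel_translate[OF integrable_n23] E_shift G r
        Bochner_Integration.integrable_add Bochner_Integration.integrable_diff integrable_lborel_translate[OF z]
        integrable_n2 integrable_n3 z)
  also have "\<dots> = I2 G + ((\<integral>s. z s \<partial>lborel) - (\<integral>s. z (s + - tau) \<partial>lborel))"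
    unfolding I2_def using integrable_n23[OF G] z integrable_lborel_translate[OF z, of "- tau"]
    by (subst Bochner_Integration.integral_add) auto
  also have "\<dots> = I2 G" by (simp add: integral_lborel_translate[of z "- tau"] del: add_uminus_conv_diff)
  finally show ?thesis
    by (simp add: I2_def integral_lborel_translate[of "\<lambda>s. n2 (\<lambda>s. G (s - r)) s + n3 (\<lambda>s. G (s - r)) s"])
qed

text \<open>For each \<open>s\<close> in \<open>(0, m]\<close> the present state is
  \<open>G 0 - T s (G s)\<close> plus \<open>T s (G s)\<close>. The first part is bounded by undoing
  the exponential weight, the second by \<open>M\<close> and the dilation energy; integrating over
  \<open>s\<close> produces the factor \<open>m\<close>.\<close>

lemma norm_present_square_le:
  assumes G: "G \<in> E" and p: "p > 0"
  shows "m * (norm (G 0))\<^sup>2 \<le> (1 + p) * ((norm W1)\<^sup>2 * exp (2 * lam * m)) * I1 G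
    + (1 + 1 / p) * (M\<^sup>2 * (norm W2)\<^sup>2) * (2 * I2 G)"
proof -
  define u where "u s = indicator {0<..m} s * (norm (R2 (G s)))\<^sup>2" for s
  have u: "integrable lborel u"
    unfolding u_def[abs_def] by (rule integrable_E[OF G, where a = 0 and b = m]) auto
  let ?c1 = "(1 + p) * ((norm W1)\<^sup>2 * exp (2 * lam * m))"
  let ?c2 = "(1 + 1 / p) * (M\<^sup>2 * (norm W2)\<^sup>2)"
  have "u s \<le> 2 * (n2 G (s + - tau) + n3 G s)" for s
  proof (cases "s \<in> {0<..m}")
    case False
    then show ?thesis using n_nonneg[of G] by (simp add: u_def add_nonneg_nonneg)
  next
    case True
    \<comment> \<open>\<open>T tau (G s)\<close> is the state at the next lattice point minus what
      was injected on the way. Both appear in \<open>n2\<close> at \<open>s - tau\<close>, which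
      lies in \<open>(- tau, 0]\<close> because \<open>m \<le> tau\<close>.\<close>
    have "norm (R2 (T tau (G s))) \<le> norm (R2 (G (s - tau))) + norm (R2 (G (s - tau) - T tau (G s)))"
      using norm_triangle_ineq4[of "R2 (G (s - tau))" "R2 (G (s - tau) - T tau (G s))"]
      by (simp add: blinfun.bilinear_simps)
    then have "(norm (R2 (T tau (G s))))\<^sup>2 \<le> (norm (R2 (G (s - tau))) + norm (R2 (G (s - tau) - T tau (G s))))\<^sup>2"
      by (intro power_mono) auto
    also have "\<dots> \<le> 2 * (norm (R2 (G (s - tau))))\<^sup>2 + 2 * (norm (R2 (G (s - tau) - T tau (G s))))\<^sup>2"
      using weighted_square_sum[of 1] by simp
    finally have "(norm (R2 (T tau (G s))))\<^sup>2 \<le> 2 * n2 G (s + - tau)"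
      using True m by (simp add: n2_def)
    moreover have "n3 G s = u s - (norm (R2 (T tau (G s))))\<^sup>2"
      using True by (simp add: n3_def u_def)
    \<comment> \<open>Nonnegativity allows \<open>n3\<close> to be doubled as well, giving one
      common factor 2.\<close>
    moreover have "n3 G s \<ge> 0" by (rule n_nonneg)
    ultimately show ?thesis by simp
  qed
  then have "(\<integral>s. u s \<partial>lborel) \<le> (\<integral>s. 2 * (n2 G (s + - tau) + n3 G s) \<partial>lborel)"
    by (intro integral_mono u Bochner_Integration.integrable_add integrable_mult_right
        integrable_lborel_translate integrable_n2 integrable_n3 G)
  also have "\<dots> = 2 * I2 G"
    using integrable_lborel_translate[OF integrable_n2[OF G], of "- tau"] integrable_n2[OF G] integrable_n3[OF G]
    by (simp add: I2_def integral_lborel_translate[of "n2 G" "- tau", simplified])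
  finally have uI: "(\<integral>s. u s \<partial>lborel) \<le> 2 * I2 G" .
  have "indicator {0<..m} s * (norm (G 0))\<^sup>2 \<le> ?c1 * n1 G s + ?c2 * u s" for s
  proof (cases "s \<in> {0<..m}")
    case False
    then show ?thesis by (simp add: n1_def u_def)
  next
    case True
    let ?a = "norm W1 * norm (R1 (G 0 - T s (G s)))"
    let ?b = "M * (norm W2 * norm (R2 (G s)))"
    have "norm (G 0) \<le> norm (G 0 - T s (G s)) + norm (T s (G s))"
      using norm_triangle_ineq[of "G 0 - T s (G s)" "T s (G s)"] by simp
    also have "\<dots> \<le> ?a + norm (T s) * norm (G s)"
      by (intro add_mono norm_W1 norm_blinfun)
    also have "\<dots> \<le> ?a + ?b"
      using M[of s] True m norm_W2[of "G s"] order_trans[OF norm_ge_zero M[of s]]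
      by (intro add_left_mono mult_mono) auto
    finally have "(norm (G 0))\<^sup>2 \<le> (?a + ?b)\<^sup>2" by (intro power_mono) auto
    also have "\<dots> \<le> (1 + p) * ?a\<^sup>2 + (1 + 1 / p) * ?b\<^sup>2" by (rule weighted_square_sum[OF p])
    also have "?b\<^sup>2 = M\<^sup>2 * (norm W2)\<^sup>2 * u s" using True by (simp add: u_def power_mult_distrib)
    also have "?a\<^sup>2 \<le> ((norm W1)\<^sup>2 * exp (2 * lam * m)) * n1 G s"
    proof -
      have "(norm (R1 (G 0 - T s (G s))))\<^sup>2 = exp (2 * lam * s) * n1 G s"
        using True by (simp add: n1_def power_mult_distrib flip: exp_double exp_add mult.assoc)
      also have "\<dots> \<le> exp (2 * lam * m) * n1 G s"
        using True lam n_nonneg by (intro mult_right_mono) auto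
      finally have "(norm W1)\<^sup>2 * (norm (R1 (G 0 - T s (G s))))\<^sup>2 \<le> (norm W1)\<^sup>2 * (exp (2 * lam * m) * n1 G s)"
        by (intro mult_left_mono) auto
      then show ?thesis by (simp add: power_mult_distrib algebra_simps)
    qed
    finally show ?thesis using True p by (simp add: mult.assoc)
  qed
  then have "(\<integral>s. indicator {0<..m} s * (norm (G 0))\<^sup>2 \<partial>lborel) \<le> (\<integral>s. ?c1 * n1 G s + ?c2 * u s \<partial>lborel)"
    using m by (intro integral_mono Bochner_Integration.integrable_add integrable_mult_right integrable_n1 G u
        integrable_mult_left) auto
  also have "(\<integral>s. indicator {0<..m} s * (norm (G 0))\<^sup>2 \<partial>lborel) = m * (norm (G 0))\<^sup>2"
    using m by simp
  also have "(\<integral>s. ?c1 * n1 G s + ?c2 * u s \<partial>lborel) = ?c1 * I1 G + ?c2 * (\<integral>s. u s \<partial>lborel)"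
    using integrable_n1[OF G] u by (simp add: I1_def)
  also have "\<dots> \<le> ?c1 * I1 G + ?c2 * (2 * I2 G)"
    using p by (intro add_left_mono mult_left_mono uI) auto
  finally show ?thesis .
qed

text \<open>With the only injection at time 0, the recent contribution is \<open>x\<close> for every
  \<open>s > 0\<close>, so only the exponential weight is integrated.\<close>

lemma I1_start: "I1 (start x) \<le> (norm R1)\<^sup>2 * ((1 - exp (- 2 * lam * m)) / (2 * lam)) * (norm x)\<^sup>2"
proof -
  have D: "((\<lambda>s. (- 1 / (2 * lam)) * exp (- 2 * lam * s)) has_real_derivative exp (- 2 * lam * s)) (at s)" for s
    using lam by (auto intro!: derivative_eq_intros)
  have "(\<integral>s. indicator {0..m} s * exp (- 2 * lam * s) \<partial>lborel)
      = (- 1 / (2 * lam)) * exp (- 2 * lam * m) - (- 1 / (2 * lam)) * exp (- 2 * lam * 0)"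
    using integral_FTC_Icc_real[of 0 m "\<lambda>s. (- 1 / (2 * lam)) * exp (- 2 * lam * s)" "\<lambda>s. exp (- 2 * lam * s)"] m D
    by (simp only: mult.commute[of "indicator _ _"]) (auto intro!: continuous_intros)
  also have "\<dots> = (1 - exp (- 2 * lam * m)) / (2 * lam)" using lam by (simp add: field_simps)
  finally have exp_integral:
    "(\<integral>s. indicator {0..m} s * exp (- 2 * lam * s) \<partial>lborel) = (1 - exp (- 2 * lam * m)) / (2 * lam)" .
  \<comment> \<open>\<open>n1\<close> omits the endpoint 0, which the closed interval contains; the
    difference is a null set.\<close>
  have eq: "n1 (start x) s = (norm (R1 x))\<^sup>2 * (indicator {0..m} s * exp (- 2 * lam * s))" if "s \<noteq> 0" for s
  proof -
    have "(exp (- lam * s))\<^sup>2 = exp (- 2 * lam * s)" by (simp flip: exp_double)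
    then show ?thesis using that
      by (auto simp: n1_def start_def T_simps indicator_def power_mult_distrib)
  qed
  have "I1 (start x) = (\<integral>s. (norm (R1 x))\<^sup>2 * (indicator {0..m} s * exp (- 2 * lam * s)) \<partial>lborel)"
    unfolding I1_def
  proof (rule integral_cong_AE)
    show "n1 (start x) \<in> borel_measurable lborel" using integrable_n1[OF start_in_E] by auto
    show "AE s in lborel. n1 (start x) s = (norm (R1 x))\<^sup>2 * (indicator {0..m} s * exp (- 2 * lam * s))"
      using AE_lborel_singleton[of "0::real"] by eventually_elim (rule eq)
  qed simp
  also have "\<dots> = (norm (R1 x))\<^sup>2 * (\<integral>s. indicator {0..m} s * exp (- 2 * lam * s) \<partial>lborel)" by simp
  also note exp_integral
  also have "(norm (R1 x))\<^sup>2 * ((1 - exp (- 2 * lam * m)) / (2 * lam))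
      \<le> (norm R1 * norm x)\<^sup>2 * ((1 - exp (- 2 * lam * m)) / (2 * lam))"
    using lam m by (intro mult_right_mono power_mono norm_blinfun divide_nonneg_pos) auto
  finally show ?thesis by (simp add: power_mult_distrib algebra_simps)
qed

text \<open>In the window the state is \<open>T (- s) x\<close> and the preceding lattice state is
  0, so both summands of \<open>n2\<close> are the same square. This gives the factor 2, while
  \<open>n3\<close> vanishes.\<close>

lemma I2_start: "I2 (start x) \<le> 2 * tau * ((norm R2)\<^sup>2 * M\<^sup>2) * (norm x)\<^sup>2"
proof -
  have "n2 (start x) s + n3 (start x) s \<le> indicator {- tau<..0} s * (2 * (((norm R2)\<^sup>2 * M\<^sup>2) * (norm x)\<^sup>2))" for s
  proof (cases "s \<in> {- tau<..0}")
    case True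
    have "norm (R2 (T (- s) x)) \<le> norm R2 * (norm (T (- s)) * norm x)"
      by (intro order_trans[OF norm_blinfun] mult_left_mono norm_blinfun) auto
    also have "\<dots> \<le> norm R2 * (M * norm x)"
      using True by (intro mult_left_mono mult_right_mono M) auto
    finally have "(norm (R2 (T (- s) x)))\<^sup>2 \<le> (norm R2 * (M * norm x))\<^sup>2" by (intro power_mono) auto
    then show ?thesis using True by (simp add: n2_def n3_def start_def power_mult_distrib mult.assoc)
  qed (auto simp: n2_def n3_def start_def)
  then have "I2 (start x) \<le> (\<integral>s. indicator {- tau<..0} s * (2 * (((norm R2)\<^sup>2 * M\<^sup>2) * (norm x)\<^sup>2)) \<partial>lborel)"
    unfolding I2_def using tau by (intro integral_mono integrable_n23 start_in_E integrable_mult_left) auto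
  also have "\<dots> = tau * (2 * (((norm R2)\<^sup>2 * M\<^sup>2) * (norm x)\<^sup>2))" using tau by simp
  finally show ?thesis by (simp add: algebra_simps)
qed

section \<open>Quadratic structure of the energies and invariance under \<open>J\<close>\<close>

lemma I_parallelogram:
  assumes G: "G \<in> E" and H: "H \<in> E"
  shows "I1 (\<lambda>s. G s + H s) + I1 (\<lambda>s. G s - H s) = 2 * I1 G + 2 * I1 H"
    and "I2 (\<lambda>s. G s + H s) + I2 (\<lambda>s. G s - H s) = 2 * I2 G + 2 * I2 H"
proof -
  have par: "(norm (A (x + y)))\<^sup>2 + (norm (A (x - y)))\<^sup>2 = 2 * (norm (A x))\<^sup>2 + 2 * (norm (A y))\<^sup>2"
    for A :: "'a \<Rightarrow>\<^sub>L 'a" and x y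
    using norm_parallelogram[of "A x" "A y"] by (simp add: blinfun.bilinear_simps)
  have p1: "n1 (\<lambda>s. G s + H s) s + n1 (\<lambda>s. G s - H s) s = 2 * n1 G s + 2 * n1 H s" for s
    using par[of "exp (- lam * s) *\<^sub>R R1" "G 0 - T s (G s)" "H 0 - T s (H s)"]
    by (auto simp: n1_def indicator_def blinfun.bilinear_simps algebra_simps)
  have p2: "n2 (\<lambda>s. G s + H s) s + n2 (\<lambda>s. G s - H s) s = 2 * n2 G s + 2 * n2 H s" for s
    using par[of R2 "G s" "H s"] par[of R2 "G s - T tau (G (s + tau))" "H s - T tau (H (s + tau))"]
    by (auto simp: n2_def indicator_def blinfun.bilinear_simps algebra_simps)
  have p3: "n3 (\<lambda>s. G s + H s) s + n3 (\<lambda>s. G s - H s) s = 2 * n3 G s + 2 * n3 H s" for s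
    using par[of R2 "G s" "H s"] par[of R2 "T tau (G s)" "T tau (H s)"]
    by (auto simp: n3_def indicator_def blinfun.bilinear_simps algebra_simps)
  have p23: "(n2 (\<lambda>s. G s + H s) s + n3 (\<lambda>s. G s + H s) s) + (n2 (\<lambda>s. G s - H s) s + n3 (\<lambda>s. G s - H s) s)
      = 2 * (n2 G s + n3 G s) + 2 * (n2 H s + n3 H s)" for s
    using p2[of s] p3[of s] by (simp add: algebra_simps)
  have combine: "(\<integral>s. f s \<partial>lborel) + (\<integral>s. g s \<partial>lborel) = 2 * (\<integral>s. h s \<partial>lborel) + 2 * (\<integral>s. k s \<partial>lborel)"
    if "integrable lborel f" "integrable lborel g" "integrable lborel h" "integrable lborel k"
      "\<And>s. f s + g s = 2 * h s + 2 * k s" for f g h k :: "real \<Rightarrow> real"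
  proof -
    have "(\<integral>s. f s \<partial>lborel) + (\<integral>s. g s \<partial>lborel) = (\<integral>s. f s + g s \<partial>lborel)"
      using that by (intro Bochner_Integration.integral_add[symmetric])
    also have "\<dots> = (\<integral>s. 2 * h s + 2 * k s \<partial>lborel)" by (simp only: that(5))
    also have "\<dots> = 2 * (\<integral>s. h s \<partial>lborel) + 2 * (\<integral>s. k s \<partial>lborel)"
      using that by (subst Bochner_Integration.integral_add) auto
    finally show ?thesis .
  qed
  note GH = E_add[OF G H] E_diff[OF G H] G H
  show "I1 (\<lambda>s. G s + H s) + I1 (\<lambda>s. G s - H s) = 2 * I1 G + 2 * I1 H"
    unfolding I1_def by (rule combine) (intro integrable_n1 GH p1)+
  show "I2 (\<lambda>s. G s + H s) + I2 (\<lambda>s. G s - H s) = 2 * I2 G + 2 * I2 H"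
    unfolding I2_def by (rule combine) (intro integrable_n23 GH p23)+
qed

lemma I_scale: "I1 (\<lambda>s. c *\<^sub>R G s) = c\<^sup>2 * I1 G" "I2 (\<lambda>s. c *\<^sub>R G s) = c\<^sup>2 * I2 G"
proof -
  have "n1 (\<lambda>s. c *\<^sub>R G s) s = c\<^sup>2 * n1 G s" for s
    by (simp add: n1_def blinfun.bilinear_simps power_mult_distrib flip: scaleR_diff_right)
  then show "I1 (\<lambda>s. c *\<^sub>R G s) = c\<^sup>2 * I1 G" by (simp add: I1_def)
  have "n2 (\<lambda>s. c *\<^sub>R G s) s + n3 (\<lambda>s. c *\<^sub>R G s) s = c\<^sup>2 * (n2 G s + n3 G s)" for s
    by (simp add: n2_def n3_def blinfun.bilinear_simps power_mult_distrib algebra_simps flip: scaleR_diff_right)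
  then show "I2 (\<lambda>s. c *\<^sub>R G s) = c\<^sup>2 * I2 G" by (simp add: I2_def)
qed

lemma I_J: "I1 (\<lambda>s. J (G s)) = I1 G" "I2 (\<lambda>s. J (G s)) = I2 G"
proof -
  have "n1 (\<lambda>s. J (G s)) s = n1 G s" for s
  proof (cases "s \<ge> 0")
    case True
    have "J (G 0) - T s (J (G s)) = J (G 0 - T s (G s))" using True by (simp add: T_simps J_simps)
    then show ?thesis by (simp add: n1_def J_R J_simps(5))
  qed (simp add: n1_def)
  then show "I1 (\<lambda>s. J (G s)) = I1 G" by (simp add: I1_def)
  have "n2 (\<lambda>s. J (G s)) s + n3 (\<lambda>s. J (G s)) s = n2 G s + n3 G s" for s
  proof -
    have "J (G s) - T tau (J (G (s + tau))) = J (G s - T tau (G (s + tau)))" "T tau (J (G s)) = J (T tau (G s))"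
      using tau by (simp_all add: T_simps J_simps)
    then show ?thesis by (simp add: n2_def n3_def J_R J_simps(5))
  qed
  then show "I2 (\<lambda>s. J (G s)) = I2 G" by (simp add: I2_def)
qed

subsection \<open>The quotient norm\<close>

text \<open>\<open>q\<close> is the quotient of the energy \<open>N\<close> over histories with a
  given present state. Shifting a history of \<open>x\<close> gives one of \<open>T t x\<close> with
  no more energy, so the renorming attached to \<open>q\<close> makes every \<open>T t\<close> a
  contraction.\<close>

lemma similar_to_contractions:
  assumes k: "k1 \<ge> 1" "k2 > 0"
    and k1: "(norm R1 * norm W1)\<^sup>2 * ((exp (2 * lam * m) - 1) / (2 * lam * m)) \<le> k1\<^sup>2"
    and k2: "(2 * M\<^sup>2 * (norm R2 * norm W2))\<^sup>2 * (tau / m) \<le> k2\<^sup>2"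
  shows "\<exists>R W. inv_pair J R W \<and> norm R * norm W \<le> k1 + k2 \<and> (\<forall>t\<ge>0. norm (R o\<^sub>L T t o\<^sub>L W) \<le> 1)"
proof -
  \<comment> \<open>The optimal weight: it turns
    \<open>(1 + p) * k1\<^sup>2 + (1 + 1 / p) * k2\<^sup>2\<close> into
    \<open>(k1 + k2)\<^sup>2\<close>.\<close>
  define p where "p = k2 / k1"
  have p: "p > 0" using k by (simp add: p_def)
  \<comment> \<open>The coefficients of \<open>norm_present_square_le\<close> divided by
    \<open>m\<close>, so that \<open>N\<close> dominates the squared norm of the present
    state.\<close>
  define al where "al = (1 + p) * ((norm W1)\<^sup>2 * exp (2 * lam * m)) / m"
  define be where "be = (1 + 1 / p) * (M\<^sup>2 * (norm W2)\<^sup>2) * 2 / m"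
  have albe: "al \<ge> 0" "be \<ge> 0" using p m by (auto simp: al_def be_def)
  define N where "N G = al * I1 G + be * I2 G" for G
  define q where "q x = Inf (N ` {G \<in> E. G 0 = x})" for x
  have N_lower: "(norm (G 0))\<^sup>2 \<le> N G" if "G \<in> E" for G
  proof -
    have "m * (norm (G 0))\<^sup>2 \<le> m * N G"
    proof -
      have "m * al = (1 + p) * ((norm W1)\<^sup>2 * exp (2 * lam * m))"
        "m * be = (1 + 1 / p) * (M\<^sup>2 * (norm W2)\<^sup>2) * 2"
        using m by (simp_all add: al_def be_def)
      then show ?thesis
        using norm_present_square_le[OF that p] by (simp add: N_def distrib_left flip: mult.assoc)
    qed
    then show ?thesis using m by simp
  qed
  have N_start: "N (start x) \<le> (k1 + k2)\<^sup>2 * (norm x)\<^sup>2" for x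
  proof -
    have "al * I1 (start x) \<le> al * ((norm R1)\<^sup>2 * ((1 - exp (- 2 * lam * m)) / (2 * lam)) * (norm x)\<^sup>2)"
      by (intro mult_left_mono I1_start albe)
    also have "\<dots> = (1 + p) * ((norm R1 * norm W1)\<^sup>2 *
        ((exp (2 * lam * m) * (1 - exp (- 2 * lam * m))) / (2 * lam * m))) * (norm x)\<^sup>2"
      using lam m by (simp add: al_def power_mult_distrib mult_ac)
    also have "exp (2 * lam * m) * (1 - exp (- 2 * lam * m)) = exp (2 * lam * m) - 1"
      by (simp add: right_diff_distrib flip: exp_add)
    also have "(1 + p) * ((norm R1 * norm W1)\<^sup>2 * ((exp (2 * lam * m) - 1) / (2 * lam * m))) * (norm x)\<^sup>2
        \<le> (1 + p) * k1\<^sup>2 * (norm x)\<^sup>2"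
      using p by (intro mult_right_mono mult_left_mono k1) auto
    finally have 1: "al * I1 (start x) \<le> (1 + p) * k1\<^sup>2 * (norm x)\<^sup>2" .
    have "be * I2 (start x) \<le> be * (2 * tau * ((norm R2)\<^sup>2 * M\<^sup>2) * (norm x)\<^sup>2)"
      by (intro mult_left_mono I2_start albe)
    also have "\<dots> = (1 + 1 / p) * ((2 * M\<^sup>2 * (norm R2 * norm W2))\<^sup>2 * (tau / m)) * (norm x)\<^sup>2"
      by (simp add: be_def power_mult_distrib power2_eq_square)
    also have "\<dots> \<le> (1 + 1 / p) * k2\<^sup>2 * (norm x)\<^sup>2"
      using p by (intro mult_right_mono mult_left_mono k2) auto
    finally have 2: "be * I2 (start x) \<le> (1 + 1 / p) * k2\<^sup>2 * (norm x)\<^sup>2" .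
    have "(1 + p) * k1\<^sup>2 + (1 + 1 / p) * k2\<^sup>2 = (k1 + k2)\<^sup>2"
      using k by (simp add: p_def power2_eq_square field_simps)
    then have "(1 + p) * k1\<^sup>2 * (norm x)\<^sup>2 + (1 + 1 / p) * k2\<^sup>2 * (norm x)\<^sup>2 = (k1 + k2)\<^sup>2 * (norm x)\<^sup>2"
      by (simp flip: distrib_right)
    then show ?thesis using 1 2 by (simp add: N_def)
  qed
  have bdd: "bdd_below (N ` {G \<in> E. G 0 = x})" for x
    by (rule bdd_belowI2[where m = 0]) (simp add: N_def albe I_nonneg)
  have ne: "N ` {G \<in> E. G 0 = x} \<noteq> {}" for x using start_in_E[of x] by force
  have q_le: "q x \<le> N G" if "G \<in> E" "G 0 = x" for G x
    unfolding q_def by (rule cInf_lower[OF _ bdd]) (use that in auto)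
  have q_ge: "c \<le> q x" if "\<And>G. G \<in> E \<Longrightarrow> G 0 = x \<Longrightarrow> c \<le> N G" for c x
    unfolding q_def by (rule cInf_greatest[OF ne]) (use that in auto)
  have q_approx: "\<exists>G\<in>E. G 0 = x \<and> N G < q x + e" if "e > 0" for x e
    using cInf_lessD[OF ne, of x "q x + e"] that unfolding q_def by auto
  have N_par: "N (\<lambda>s. G s + H s) + N (\<lambda>s. G s - H s) = 2 * N G + 2 * N H" if "G \<in> E" "H \<in> E" for G H
  proof -
    have "N (\<lambda>s. G s + H s) + N (\<lambda>s. G s - H s) = al * (I1 (\<lambda>s. G s + H s) + I1 (\<lambda>s. G s - H s))
        + be * (I2 (\<lambda>s. G s + H s) + I2 (\<lambda>s. G s - H s))"
      by (simp add: N_def algebra_simps)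
    then show ?thesis unfolding I_parallelogram[OF that] by (simp add: N_def algebra_simps)
  qed
  \<comment> \<open>Near-minimisers for \<open>x\<close> and \<open>y\<close> combine into histories
    of \<open>x + y\<close> and \<open>x - y\<close>.\<close>
  have par_le: "q (x + y) + q (x - y) \<le> 2 * q x + 2 * q y" for x y
  proof (rule field_le_epsilon)
    fix e :: real assume "e > 0"
    then have "e / 4 > 0" by simp
    obtain G where G: "G \<in> E" "G 0 = x" "N G < q x + e / 4" using q_approx[OF \<open>e / 4 > 0\<close>] by blast
    obtain H where H: "H \<in> E" "H 0 = y" "N H < q y + e / 4" using q_approx[OF \<open>e / 4 > 0\<close>] by blast
    have "q (x + y) \<le> N (\<lambda>s. G s + H s)" "q (x - y) \<le> N (\<lambda>s. G s - H s)"
      using G H by (auto intro!: q_le E_add E_diff)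
    then show "q (x + y) + q (x - y) \<le> 2 * q x + 2 * q y + e"
      using N_par[OF G(1) H(1)] G(3) H(3) by (simp add: field_simps)
  qed
  have q_scale: "q (c *\<^sub>R x) \<le> c\<^sup>2 * q x" for c x
  proof (rule field_le_epsilon)
    fix e :: real assume "e > 0"
    then have "e / (c\<^sup>2 + 1) > 0" by (simp add: add_nonneg_pos)
    then obtain G where G: "G \<in> E" "G 0 = x" "N G < q x + e / (c\<^sup>2 + 1)" using q_approx by blast
    have "q (c *\<^sub>R x) \<le> N (\<lambda>s. c *\<^sub>R G s)" using G by (auto intro!: q_le E_scale)
    also have "\<dots> = c\<^sup>2 * N G" by (simp add: N_def I_scale algebra_simps)
    also have "\<dots> \<le> c\<^sup>2 * (q x + e / (c\<^sup>2 + 1))" using G by (intro mult_left_mono) auto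
    also have "\<dots> = c\<^sup>2 * q x + e * (c\<^sup>2 / (c\<^sup>2 + 1))" by (simp add: algebra_simps)
    also have "\<dots> \<le> c\<^sup>2 * q x + e * 1"
      using \<open>e > 0\<close> by (intro add_left_mono mult_left_mono) (auto simp: divide_le_eq_1 add_nonneg_pos)
    finally show "q (c *\<^sub>R x) \<le> c\<^sup>2 * q x + e" by simp
  qed
  \<comment> \<open>The converse inequality is \<open>par_le\<close> at \<open>x + y\<close> and
    \<open>x - y\<close>, with the factor 4 recovered from \<open>q_scale\<close>.\<close>
  have par: "q (x + y) + q (x - y) = 2 * q x + 2 * q y" for x y
  proof -
    have double: "4 * q z \<le> q (2 *\<^sub>R z)" for z
      using q_scale[of "1/2" "2 *\<^sub>R z"] by (simp add: power2_eq_square)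
    have "q (2 *\<^sub>R x) + q (2 *\<^sub>R y) \<le> 2 * q (x + y) + 2 * q (x - y)"
      using par_le[of "x + y" "x - y"] by (simp add: scaleR_2)
    then show ?thesis using par_le[of x y] double[of x] double[of y] by linarith
  qed
  have q_ev: "q (- x) \<le> q x" for x using q_scale[of "- 1" x] by simp
  have qJ_le: "q (J x) \<le> q x" for x
  proof (rule q_ge)
    fix G assume "G \<in> E" "G 0 = x"
    then show "q (J x) \<le> N G"
      using q_le[OF E_J[of G], of "J x"] by (simp add: N_def I_J)
  qed
  have qJ: "q (J x) = q x" for x
    using qJ_le[of x] qJ_le[of "J x"] q_ev[of "- x"] by (simp add: J_simps)
  have qT: "q (T t x) \<le> q x" if t: "t \<ge> 0" for t x
  proof (rule q_ge)
    fix G assume G: "G \<in> E" "G 0 = x"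
    have "q (T t x) \<le> N (\<lambda>s. G (s - t))"
      using E_past[OF G(1), of "- t"] t G by (intro q_le E_shift) auto
    also have "\<dots> \<le> N G"
      unfolding N_def by (intro add_mono mult_left_mono I1_shift I2_shift G t albe)
    finally show "q (T t x) \<le> N G" .
  qed
  obtain R W where RW: "inv_pair J R W" "norm R * norm W \<le> k1 + k2" "\<And>x. (norm (R x))\<^sup>2 = q x"
  proof -
    have "\<exists>R W. inv_pair J R W \<and> norm R * norm W \<le> k1 + k2 \<and> (\<forall>x. (norm (R x))\<^sup>2 = q x)"
    proof (rule hilbertian_renorming[OF J par])
      show "(norm x)\<^sup>2 \<le> q x" for x by (rule q_ge) (use N_lower in blast)
      show "q x \<le> (k1 + k2)\<^sup>2 * (norm x)\<^sup>2" for x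
        by (rule order_trans[OF q_le[OF start_in_E] N_start]) simp
    qed (use qJ k in auto)
    then show ?thesis using that by blast
  qed
  have "norm (R o\<^sub>L T t o\<^sub>L W) \<le> 1" if "t \<ge> 0" for t
  proof (rule norm_blinfun_bound)
    fix x
    have "R (W x) = x" using RW(1) unfolding inv_pair_def
      by (metis blinfun_apply_blinfun_compose blinfun_apply_id_blinfun)
    then have "(norm (R (T t (W x))))\<^sup>2 \<le> (norm x)\<^sup>2"
      using qT[OF that, of "W x"] RW(3)[of "W x"] RW(3)[of "T t (W x)"] by simp
    then show "norm ((R o\<^sub>L T t o\<^sub>L W) x) \<le> 1 * norm x" by simp
  qed simp
  then show ?thesis using RW by blast
qed

end

section \<open>Choice of the window and passage to infima\<close>

lemma inv_pair_norm_ge_1: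
  fixes x :: "'a::real_normed_vector" and R W :: "'a \<Rightarrow>\<^sub>L 'a"
  assumes "inv_pair J R W" "x \<noteq> 0"
  shows "norm R * norm W \<ge> 1"
proof -
  have "norm x = norm (R (W x))"
    using assms(1) unfolding inv_pair_def by (metis blinfun_apply_blinfun_compose blinfun_apply_id_blinfun)
  also have "\<dots> \<le> norm R * (norm W * norm x)"
    by (intro order_trans[OF norm_blinfun] mult_left_mono norm_blinfun) auto
  finally have "1 * norm x \<le> (norm R * norm W) * norm x" by (simp add: mult.assoc)
  then show ?thesis using assms(2) by simp
qed

text \<open>Convexity of \<open>exp\<close>: the slope of the chord from 0 grows with its
  endpoint.\<close>

lemma exp_quotient_mono:
  fixes a m :: real
  assumes "a > 0" "0 < m" "m \<le> 1"
  shows "(exp (a * m) - 1) / (a * m) \<le> (exp a - 1) / a"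
proof -
  have "exp ((1 - m) *\<^sub>R 0 + m *\<^sub>R a) \<le> (1 - m) * exp 0 + m * exp a"
    using assms by (intro convex_onD[OF exp_convex]) auto
  then have "exp (a * m) - 1 \<le> m * (exp a - 1)" by (simp add: algebra_simps)
  then have "(exp (a * m) - 1) / (a * m) \<le> (m * (exp a - 1)) / (a * m)"
    using assms by (intro divide_right_mono) auto
  then show ?thesis using assms by simp
qed

lemma similarity_constant_bound:
  fixes J :: "'a::{real_inner, complete_space} \<Rightarrow> 'a"
  assumes J: "complex_structure J" and C0: "C0_semigroup J T" and lam: "lam > 0" and tau: "tau > 0"
    and 1: "inv_pair J R1 W1" "\<And>t. t \<ge> 0 \<Longrightarrow> norm (R1 o\<^sub>L (exp (- lam * t) *\<^sub>R T t) o\<^sub>L W1) \<le> 1"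
    and 2: "inv_pair J R2 W2" "norm (R2 o\<^sub>L T tau o\<^sub>L W2) \<le> 1"
  defines "M \<equiv> SUP t\<in>{0..tau}. norm (T t)"
  shows "\<exists>R W. inv_pair J R W \<and> (\<forall>t\<ge>0. norm (R o\<^sub>L T t o\<^sub>L W) \<le> 1) \<and>
    norm R * norm W \<le> norm R1 * norm W1 * ((exp (2 * lam) - 1) / (2 * lam))
      + 2 * (norm R2 * norm W2) * (M\<^sup>2 * max 1 (sqrt tau))"
proof (cases "\<exists>x :: 'a. x \<noteq> 0")
  case False
  \<comment> \<open>On the zero space even the identity has norm 0, so condition numbers are not at
    least 1; the identity itself serves as similarity.\<close>
  then have zero: "A = 0" for A :: "'a \<Rightarrow>\<^sub>L 'a" by (intro blinfun_eqI) metis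
  have "inv_pair J id_blinfun id_blinfun" by (auto simp: inv_pair_def cplx_op_def intro: blinfun_eqI)
  moreover have "norm (id_blinfun o\<^sub>L T t o\<^sub>L id_blinfun) \<le> 1" for t by (simp add: zero[of "T t"])
  moreover have "norm (id_blinfun :: 'a \<Rightarrow>\<^sub>L 'a) * norm (id_blinfun :: 'a \<Rightarrow>\<^sub>L 'a)
      \<le> norm R1 * norm W1 * ((exp (2 * lam) - 1) / (2 * lam))
        + 2 * (norm R2 * norm W2) * (M\<^sup>2 * max 1 (sqrt tau))"
    unfolding zero[of id_blinfun] using lam
    by (simp add: add_nonneg_nonneg del: times_divide_eq_right)
  ultimately show ?thesis by blast
next
  case True
  then obtain x0 :: 'a where x0: "x0 \<noteq> 0" by blast
  \<comment> \<open>A window of length at most 1 keeps the exponential factor below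
    \<open>Y\<close>, and \<open>tau / m\<close> becomes the square of
    \<open>max 1 (sqrt tau)\<close>.\<close>
  define m where "m = min 1 tau"
  have m01: "0 < m" "m \<le> tau" "m \<le> 1" using tau by (auto simp: m_def)
  have bdd: "bdd_above ((\<lambda>t. norm (T t)) ` {0..tau})"
  proof (rule bdd_aboveI2)
    fix t assume t: "t \<in> {0..tau}"
    \<comment> \<open>Undoing the similarity and the weight bounds the norms on
      \<open>[0, tau]\<close>, so that the supremum \<open>M\<close> is a genuine upper
      bound.\<close>
    have "T t = (exp (lam * t)) *\<^sub>R (W1 o\<^sub>L (R1 o\<^sub>L (exp (- lam * t) *\<^sub>R T t) o\<^sub>L W1) o\<^sub>L R1)"
    proof (rule blinfun_eqI)
      fix x
      have "W1 (R1 y) = y" for y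
        using 1(1) unfolding inv_pair_def by (metis blinfun_apply_blinfun_compose blinfun_apply_id_blinfun)
      then show "T t x = (exp (lam * t) *\<^sub>R (W1 o\<^sub>L (R1 o\<^sub>L (exp (- lam * t) *\<^sub>R T t) o\<^sub>L W1) o\<^sub>L R1)) x"
        by (simp add: blinfun.bilinear_simps flip: exp_add)
    qed
    then have "norm (T t) = exp (lam * t) * norm (W1 o\<^sub>L (R1 o\<^sub>L (exp (- lam * t) *\<^sub>R T t) o\<^sub>L W1) o\<^sub>L R1)"
      by (metis abs_exp_cancel norm_scaleR)
    also have "\<dots> \<le> exp (lam * tau) * (norm W1 * 1 * norm R1)"
    proof (rule mult_mono)
      have "norm (W1 o\<^sub>L (R1 o\<^sub>L (exp (- lam * t) *\<^sub>R T t) o\<^sub>L W1)) \<le> norm W1 * 1"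
        by (rule order_trans[OF norm_blinfun_compose mult_left_mono]) (use t 1(2) in auto)
      then show "norm (W1 o\<^sub>L (R1 o\<^sub>L (exp (- lam * t) *\<^sub>R T t) o\<^sub>L W1) o\<^sub>L R1) \<le> norm W1 * 1 * norm R1"
        by (rule order_trans[OF norm_blinfun_compose mult_right_mono]) simp
    qed (use t lam in auto)
    finally show "norm (T t) \<le> exp (lam * tau) * (norm W1 * 1 * norm R1)" .
  qed
  have M: "norm (T t) \<le> M" if "0 \<le> t" "t \<le> tau" for t
    unfolding M_def using that by (intro cSUP_upper bdd) auto
  have "1 \<le> norm (T 0)"
  proof -
    have "T 0 = id_blinfun" using C0 by (simp add: C0_semigroup_def)
    then show ?thesis using norm_blinfun[of "T 0" x0] x0 by simp
  qed
  then have M1: "M \<ge> 1" using M[of 0] tau by simp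
  interpret similar_semigroup J T lam tau m M R1 W1 R2 W2
    by unfold_locales (use assms m01 M in auto)
  define c1 where "c1 = norm R1 * norm W1"
  define c2 where "c2 = norm R2 * norm W2"
  have c: "c1 \<ge> 1" "c2 \<ge> 1" using inv_pair_norm_ge_1 1(1) 2(1) x0 by (auto simp: c1_def c2_def)
  define Y where "Y = (exp (2 * lam) - 1) / (2 * lam)"
  have "2 * lam \<le> exp (2 * lam) - 1" using exp_ge_add_one_self[of "2 * lam"] by linarith
  then have Y: "Y \<ge> 1" using lam by (simp add: Y_def)
  define k1 where "k1 = c1 * Y"
  define k2 where "k2 = 2 * c2 * (M\<^sup>2 * max 1 (sqrt tau))"
  have "\<exists>R W. inv_pair J R W \<and> norm R * norm W \<le> k1 + k2 \<and> (\<forall>t\<ge>0. norm (R o\<^sub>L T t o\<^sub>L W) \<le> 1)"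
  proof (rule similar_to_contractions)
    show "k1 \<ge> 1" using mult_mono[OF c(1) Y] c by (simp add: k1_def)
    show "k2 > 0" using c M1 by (auto simp: k2_def)
    have "(exp (2 * lam * m) - 1) / (2 * lam * m) \<le> Y"
      unfolding Y_def by (rule exp_quotient_mono) (use lam m01 in auto)
    \<comment> \<open>\<open>k1\<close> carries \<open>Y\<close> rather than its square root, a
      weakening because \<open>Y \<ge> 1\<close>.\<close>
    also have "\<dots> \<le> Y\<^sup>2" using Y by (simp add: power2_eq_square)
    finally have "c1\<^sup>2 * ((exp (2 * lam * m) - 1) / (2 * lam * m)) \<le> c1\<^sup>2 * Y\<^sup>2"
      by (intro mult_left_mono) auto
    then show "(norm R1 * norm W1)\<^sup>2 * ((exp (2 * lam * m) - 1) / (2 * lam * m)) \<le> k1\<^sup>2"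
      by (simp add: k1_def c1_def power_mult_distrib)
    have "tau / m = (max 1 (sqrt tau))\<^sup>2" using tau by (auto simp: m_def max_def min_def)
    then show "(2 * M\<^sup>2 * (norm R2 * norm W2))\<^sup>2 * (tau / m) \<le> k2\<^sup>2"
      by (simp add: k2_def c2_def power_mult_distrib)
  qed
  then show ?thesis unfolding k1_def k2_def c1_def c2_def Y_def by blast
qed

theorem theorem5p1:
  fixes J :: "'a::{real_inner, complete_space} \<Rightarrow> 'a"
    and T :: "real \<Rightarrow> ('a \<Rightarrow>\<^sub>L 'a)"
    and lam tau :: real
  assumes "complex_structure J"
    and "C0_semigroup J T"
    and "lam > 0" and "tau > 0"
    and "sg_similar_to_contractions J (\<lambda>t. exp (- lam * t) *\<^sub>R T t)"
    and "similar_to_contraction J (T tau)"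
  shows "sg_similar_to_contractions J T \<and>
    sg_sim_const J T \<le>
      ereal (sqrt 2) * sg_sim_const J (\<lambda>t. exp (- lam * t) *\<^sub>R T t)
        * ereal ((exp (2 * lam) - 1) / (2 * lam))
      + ereal (2 * sqrt 2) * sim_const J (T tau)
        * ereal ((SUP t\<in>{0..tau}. norm (T t)) ^ 2 * max 1 (sqrt tau))"
proof -
  define S where "S = (\<lambda>t. exp (- lam * t) *\<^sub>R T t)"
  define Y where "Y = (exp (2 * lam) - 1) / (2 * lam)"
  define Z where "Z = (SUP t\<in>{0..tau}. norm (T t))\<^sup>2 * max 1 (sqrt tau)"
  have YZ: "Y > 0" "Z \<ge> 0" using \<open>lam > 0\<close> by (simp_all add: Y_def Z_def)
  define P1 where "P1 = {norm R * norm W | R W. inv_pair J R W \<and> (\<forall>t\<ge>0. norm (R o\<^sub>L S t o\<^sub>L W) \<le> 1)}"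
  define P2 where "P2 = {norm R * norm W | R W. inv_pair J R W \<and> norm (R o\<^sub>L T tau o\<^sub>L W) \<le> 1}"
  define P where "P = {norm R * norm W | R W. inv_pair J R W \<and> (\<forall>t\<ge>0. norm (R o\<^sub>L T t o\<^sub>L W) \<le> 1)}"
  have nonneg: "\<And>c. c \<in> P1 \<Longrightarrow> 0 \<le> c" "\<And>c. c \<in> P2 \<Longrightarrow> 0 \<le> c" "\<And>c. c \<in> P \<Longrightarrow> 0 \<le> c"
    by (auto simp: P1_def P2_def P_def)
  have ne: "P1 \<noteq> {}" "P2 \<noteq> {}"
    using assms(5,6) by (auto simp: P1_def P2_def S_def sg_similar_to_contractions_def similar_to_contraction_def)
  have bound: "\<exists>c\<in>P. c \<le> c1 * Y + 2 * c2 * Z" if "c1 \<in> P1" "c2 \<in> P2" for c1 c2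
    using that similarity_constant_bound[OF assms(1-4)]
    unfolding P1_def P2_def P_def S_def Y_def Z_def by fast
  then have neP: "P \<noteq> {}" using ne by blast
  have constants: "sg_sim_const J S = ereal (Inf P1)" "sim_const J (T tau) = ereal (Inf P2)"
    "sg_sim_const J T = ereal (Inf P)"
  proof -
    \<comment> \<open>For nonempty sets of nonnegative reals the extended infimum is the real one,
      so the rest is an estimate between real numbers.\<close>
    have *: "Inf (ereal ` A) = ereal (Inf A)" if "A \<noteq> {}" "\<And>c. c \<in> A \<Longrightarrow> 0 \<le> c" for A
    proof -
      have "bdd_below A" using that(2) by (intro bdd_belowI[of _ 0])
      then show ?thesis using that by (metis ereal_Inf' )
    qed
    have "sg_sim_const J S = Inf (ereal ` P1)" "sim_const J (T tau) = Inf (ereal ` P2)"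
      "sg_sim_const J T = Inf (ereal ` P)"
      unfolding sg_sim_const_def sim_const_def P1_def P2_def P_def
      by (rule arg_cong[where f = Inf], force)+
    then show "sg_sim_const J S = ereal (Inf P1)" "sim_const J (T tau) = ereal (Inf P2)"
      "sg_sim_const J T = ereal (Inf P)"
      using * ne neP nonneg by simp_all
  qed
  have inf_nonneg: "0 \<le> Inf P1" "0 \<le> Inf P2" using ne nonneg by (auto intro!: cInf_greatest)
  have "Inf P \<le> Inf P1 * Y + 2 * Inf P2 * Z"
  proof (rule field_le_epsilon)
    fix e :: real assume e: "e > 0"
    \<comment> \<open>With this \<open>d\<close>, near-optimal \<open>c1\<close> and
      \<open>c2\<close> cost \<open>e\<close> in total.\<close>
    define d where "d = e / (Y + 2 * Z)"
    have "Y + 2 * Z > 0" using YZ by (simp add: add_pos_nonneg)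
    then have "d > 0" "d * (Y + 2 * Z) = e" using e by (simp_all add: d_def)
    then have d: "d > 0" "d * Y + 2 * d * Z = e" by (simp_all add: algebra_simps)
    obtain c1 where c1: "c1 \<in> P1" "c1 < Inf P1 + d" using cInf_lessD[OF ne(1), of "Inf P1 + d"] d by auto
    obtain c2 where c2: "c2 \<in> P2" "c2 < Inf P2 + d" using cInf_lessD[OF ne(2), of "Inf P2 + d"] d by auto
    obtain c where c: "c \<in> P" "c \<le> c1 * Y + 2 * c2 * Z" using bound[OF c1(1) c2(1)] by blast
    have "Inf P \<le> c" using nonneg(3) c by (intro cInf_lower bdd_belowI[of _ 0])
    also have "\<dots> \<le> (Inf P1 + d) * Y + 2 * (Inf P2 + d) * Z"
      using c(2) c1 c2 YZ by (elim order_trans) (intro add_mono mult_right_mono mult_left_mono, auto)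
    also have "\<dots> = Inf P1 * Y + 2 * Inf P2 * Z + e" using d(2) by (simp add: algebra_simps)
    finally show "Inf P \<le> Inf P1 * Y + 2 * Inf P2 * Z + e" .
  qed
  \<comment> \<open>The preceding bound has no \<open>sqrt 2\<close>; it is nonnegative, so the
    factor only weakens it.\<close>
  also have "\<dots> \<le> sqrt 2 * (Inf P1 * Y + 2 * Inf P2 * Z)"
    using inf_nonneg YZ mult_right_mono[of 1 "sqrt 2" "Inf P1 * Y + 2 * Inf P2 * Z"] by simp
  also have "\<dots> = sqrt 2 * Inf P1 * Y + 2 * sqrt 2 * Inf P2 * Z" by (simp add: algebra_simps)
  finally have "sg_sim_const J T \<le> ereal (sqrt 2) * sg_sim_const J S * ereal Y
      + ereal (2 * sqrt 2) * sim_const J (T tau) * ereal Z"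
    by (simp add: constants)
  moreover have "sg_similar_to_contractions J T"
    using neP by (auto simp: P_def sg_similar_to_contractions_def)
  ultimately show ?thesis by (simp add: S_def Y_def Z_def)
qed

end
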